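(* Let $\mathcal{A}=\{\mathcal{H}_m : m\in\mathbb{N}\}$ be a family of distinct hypergraphs and set $n=n(m)=|V(\mathcal{H}_m)|$. Let $r=r(n)\geq 2$, $t=t(n)$, $d=d(n)$ and $q=q(n)$ be integer functions with $(d-1)(t-1)+1\leq q\leq (d-1)t$, and let $\rho=\rho(n)\in(0,1]$ be a real function. If $$n\ln(r+1)+rt\bigl(1+\ln(d-1)\bigr)-\rho t^r\longrightarrow -\infty \quad\text{as } n\to\infty,$$ then almost surely $$\chi\bigl(\operatorname{KG}^r(\mathcal{H}_m)(\rho)\bigr)\geq \min\left\{\frac{|V(\mathcal{H}_m)|-\operatorname{alt}_r(\mathcal{H}_m,q)}{r-1},\, d\right\}.$$
   Context: A hypergraph $\mathcal{H}$ consists of a finite nonempty vertex set $V(\mathcal{H})$ and a family $E(\mathcal{H})$ of distinct nonempty subsets of $V(\mathcal{H})$ (edges). For $S\subseteq V(\mathcal{H})$, $\mathcal{H}[S]$ denotes the induced subhypergraph with vertex set $S$ whose edges are the edges of $\mathcal{H}$ contained in $S$. The chromatic number $\chi$ of a hypergraph is the least number of colors in a coloring of its vertices with no edge all of whose vertices receive the same color. For $r\geq 2$, the general Kneser hypergraph $\operatorname{KG}^r(\mathcal{H})$ has vertex set $E(\mathcal{H})$, and $\{e_1,\dots,e_r\}\subseteq E(\mathcal{H})$ is an edge iff $e_1,\dots,e_r$ are pairwise disjoint. For $\rho\in(0,1]$, the random hypergraph $\operatorname{KG}^r(\mathcal{H})(\rho)$ is the spanning subhypergraph of $\operatorname{KG}^r(\mathcal{H})$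 containing each edge of $\operatorname{KG}^r(\mathcal{H})$ independently with probability $\rho$. Alternation number: let $\mathbb{Z}_r=\{\omega^1,\dots,\omega^r\}$ be a cyclic group of order $r$ with generator $\omega$. For $X=(x_1,\dots,x_n)\in(\mathbb{Z}_r\cup\{0\})^n$, an alternating subsequence of $X$ is a sequence $x_{i_1},\dots,x_{i_k}$ ($i_1<\dots<i_k$) of nonzero entries of $X$ with $x_{i_j}\neq x_{i_{j+1}}$ for all $j\in[k-1]$; $\operatorname{alt}(X)$ is the maximum length of such a subsequence, with $\operatorname{alt}(0,\dots,0)=0$. For $i\in[r]$ let $X^i=\{j\in[n]: x_j=\omega^i\}$. For a hypergraph $\mathcal{H}$ with $|V(\mathcal{H})|=n$, a bijection $\sigma:[n]\to V(\mathcal{H})$ and a positive integer $q$, define $\operatorname{alt}_r(\mathcal{H},\sigma,q)=\max\{\operatorname{alt}(X): X\in(\mathbb{Z}_r\cup\{0\})^n,\ |E(\mathcal{H}[\sigma(X^i)])|\leq q-1 \text{ for all } i\in[r]\}$, and $\operatorname{alt}_r(\mathcal{H},q)=\min_\sigma \operatorname{alt}_r(\mathcal{H},\sigma,q)$ over all bijections $\sigma:[n]\to V(\mathcal{H})$. "Almost surely" means with probability tending to $1$ as $n\to\infty$. *)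

theory Defs
  imports "HOL-Probability.Product_PMF" "HOL-Library.Sublist"
begin

type_synonym 'a hypergraph = "'a set \<times> 'a set set"

abbreviation verts :: "'a hypergraph \<Rightarrow> 'a set" where
  "verts H \<equiv> fst H"

abbreviation edges :: "'a hypergraph \<Rightarrow> 'a set set" where
  "edges H \<equiv> snd H"

definition hypergraph :: "'a hypergraph \<Rightarrow> bool" where
  "hypergraph H \<longleftrightarrow> finite (verts H) \<and> verts H \<noteq> {} \<and>
     (\<forall>e\<in>edges H. e \<noteq> {} \<and> e \<subseteq> verts H)"

definition induced :: "'a hypergraph \<Rightarrow> 'a set \<Rightarrow> 'a hypergraph" where
  "induced H S = (S, {e \<in> edges H. e \<subseteq> S})"

definition proper_coloring :: "'a hypergraph \<Rightarrow> nat \<Rightarrow> ('a \<Rightarrow> nat) \<Rightarrow> bool" where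
  "proper_coloring H k c \<longleftrightarrow> c ` verts H \<subseteq> {..<k} \<and>
     (\<forall>e\<in>edges H. \<not> (\<exists>a. \<forall>v\<in>e. c v = a))"

text \<open>Unspecified if \<open>H\<close> has a singleton edge. This does not happen for subhypergraphs of
  \<open>KG r H\<close> below, whose edges have \<open>r \<ge> 2\<close> elements.\<close>

definition chromatic_number :: "'a hypergraph \<Rightarrow> nat" where
  "chromatic_number H = (LEAST k. \<exists>c. proper_coloring H k c)"

definition KG :: "nat \<Rightarrow> 'a hypergraph \<Rightarrow> 'a set hypergraph" where
  "KG r H = (edges H, {F. F \<subseteq> edges H \<and> card F = r \<and> pairwise disjnt F})"

definition random_KG :: "nat \<Rightarrow> 'a hypergraph \<Rightarrow> real \<Rightarrow> 'a set hypergraph pmf" where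
  "random_KG r H \<rho> =
     map_pmf (\<lambda>\<omega>. (verts (KG r H), {F \<in> edges (KG r H). \<omega> F}))
       (Pi_pmf (edges (KG r H)) False (\<lambda>_. bernoulli_pmf \<rho>))"

text \<open>A vector \<open>X\<close> over \<open>\<int>\<^sub>r \<union> {0}\<close> is a list over \<open>{0..r}\<close>, where \<open>i \<in> {1..r}\<close> stands for the
  group element \<open>\<omega>\<^sup>i\<close>; the group operation plays no role in the alternation number. Positions
  are numbered from \<open>0\<close>, so \<open>[n]\<close> becomes \<open>{..<n}\<close>.\<close>

definition alt :: "nat list \<Rightarrow> nat" where
  "alt X = Max {length Y |Y. subseq Y X \<and> 0 \<notin> set Y \<and> distinct_adj Y}"

definition positions :: "nat list \<Rightarrow> nat \<Rightarrow> nat set" where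
  "positions X i = {j. j < length X \<and> X ! j = i}"

definition alt_perm :: "nat \<Rightarrow> 'a hypergraph \<Rightarrow> (nat \<Rightarrow> 'a) \<Rightarrow> int \<Rightarrow> nat" where
  "alt_perm r H \<sigma> q =
     Max {alt X |X. length X = card (verts H) \<and> set X \<subseteq> {0..r} \<and>
       (\<forall>i\<in>{1..r}. int (card (edges (induced H (\<sigma> ` positions X i)))) \<le> q - 1)}"

definition alt_num :: "nat \<Rightarrow> 'a hypergraph \<Rightarrow> int \<Rightarrow> nat" where
  "alt_num r H q =
     Min {alt_perm r H \<sigma> q |\<sigma>. bij_betw \<sigma> {..<card (verts H)} (verts H)}"

end

theory Submission
  imports Defs "HOL-Number_Theory.Cong"
begin

text \<open>
  Fix for every vertex set \<open>A\<close> spanning at least \<open>q\<close> edges a family of exactly \<open>q\<close> of them. A colouring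
  of the Kneser hypergraph with fewer than \<open>d\<close> colours uses some colour at least \<open>t\<close> times on each
  such family, and this colours the sets \<open>A\<close> themselves. If the number of colours is also less than
  \<open>(n - alt) / (r - 1)\<close>, then the deterministic bound of Alishahi and Hajiabolhassan, applied to the
  hypergraph of the sets \<open>A\<close>, gives \<open>r\<close> disjoint sets of the same colour, hence \<open>r\<close> monochromatic
  families of \<open>t\<close> edges all of whose \<open>t\<^sup>r\<close> transversals are missing from the random hypergraph. There
  are at most \<open>(r + 1)\<^sup>n\<close> choices of the sets and \<open>(q choose t)\<^sup>r\<close> of the families, so a union bound
  finishes the proof.

  For prime \<open>r = p\<close> the deterministic bound rests on a combinatorial form of Dold's theorem: an
  equivariant labelling of the nonzero vectors of \<open>(\<int>\<^sub>p \<union> {0})\<^sup>n\<close> by \<open>\<int>\<^sub>p\<close> has a chain of \<open>n\<close> vectors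
  with distinct consecutive labels. This is because a generator of the cohomology of \<open>\<int>\<^sub>p\<close> in degree
  \<open>n - 1\<close>, pulled back along the labelling, takes the value \<open>1\<close> modulo \<open>p\<close> on an explicit chain of the
  order complex. A vector is labelled by its first nonzero entry if its alternation is small, and by
  the classes containing an edge of the least available colour otherwise. Composite \<open>r\<close> reduce to
  their factors.
\<close>

section \<open>Cochains on lists\<close>

text \<open>The alternating sum over the faces of a list. The empty list counts as a face of a
  singleton, so the complex is augmented.\<close>

fun coboundary :: "('a list \<Rightarrow> int) \<Rightarrow> 'a list \<Rightarrow> int" where
  "coboundary f [] = 0"
| "coboundary f (x # c) = f c - coboundary (\<lambda>c'. f (x # c')) c"

text \<open>Dual of inserting \<open>g y\<close> in all possible ways into a chain \<open>c\<close> lying above \<open>y\<close>; with \<open>g\<close> adding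
  a vertex, this contracts chains onto that vertex.\<close>

fun prism :: "('a \<Rightarrow> 'a) \<Rightarrow> 'a \<Rightarrow> ('a list \<Rightarrow> int) \<Rightarrow> 'a list \<Rightarrow> int" where
  "prism g y f [] = f [g y]"
| "prism g y f (x # c) = f (g y # g x # map g c) - prism g x (\<lambda>c'. f (x # c')) c"

text \<open>Alternately the operators \<open>w - 1\<close> and \<open>1 + w + \<dots> + w\<^bsup>p-1\<^esup>\<close> of the periodic resolution of
  a cyclic group; \<open>k = 0\<close> is the augmentation.\<close>

definition norm_diff :: "('a \<Rightarrow> 'a) \<Rightarrow> nat \<Rightarrow> nat \<Rightarrow> ('a list \<Rightarrow> int) \<Rightarrow> 'a list \<Rightarrow> int" where
  "norm_diff w p k f c =
     (if k = 0 then f c else if odd k then f (map w c) - f c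
      else (\<Sum>s<p. f (map (w ^^ s) c)))"

lemma coboundary_diff:
  "coboundary (\<lambda>c. f c - g c) c = coboundary f c - coboundary g c"
  by (induction c arbitrary: f g) auto

lemma coboundary_zero: "coboundary (\<lambda>c. 0) c = 0"
  by (induction c) auto

lemma coboundary_sum:
  "coboundary (\<lambda>c. \<Sum>s\<in>A. f s c) c = (\<Sum>s\<in>A. coboundary (f s) c)"
  by (induction c arbitrary: f) (auto simp: sum_subtractf)

lemma coboundary_map:
  "coboundary (\<lambda>c. f (map g c)) c = coboundary f (map g c)"
  by (induction c arbitrary: f) auto

lemma coboundary_coboundary: "coboundary (coboundary f) c = 0"
  by (induction c arbitrary: f) (auto simp: coboundary_diff)

lemma coboundary_cong_mod:
  assumes "\<And>c'. set c' \<subseteq> set c \<Longrightarrow> Suc (length c') = length c \<Longrightarrow> [f c' = g c'] (mod m)"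
  shows "[coboundary f c = coboundary g c] (mod m)"
  using assms
proof (induction c arbitrary: f g)
  case (Cons x c)
  have "[coboundary (\<lambda>c'. f (x # c')) c = coboundary (\<lambda>c'. g (x # c')) c] (mod m)"
    by (rule Cons.IH, rule Cons.prems) auto
  moreover have "[f c = g c] (mod m)"
    by (rule Cons.prems) auto
  ultimately show ?case by (simp add: cong_diff)
qed simp

text \<open>Deleting one or the other of two equal neighbours gives the same face with opposite
  signs, and all other faces stay degenerate. Cochains that vanish on degenerate lists thus form a
  subcomplex.\<close>

lemma coboundary_not_distinct_adj:
  assumes "\<And>c. \<not> distinct_adj c \<Longrightarrow> f c = 0" "\<not> distinct_adj c"
  shows "coboundary f c = 0"
  using assms
proof (induction c arbitrary: f rule: induct_list012)
  case (3 x y c)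
  show ?case
  proof (cases "x = y")
    case True
    then have "(\<lambda>c''. f (x # y # c'')) = (\<lambda>_. 0)"
      using "3.prems"(1) by (auto simp: fun_eq_iff)
    then show ?thesis using True by (simp add: coboundary_zero)
  next
    case False
    then have nd: "\<not> distinct_adj (y # c)" using "3.prems"(2) by simp
    have "coboundary (\<lambda>c'. f (x # c')) (y # c) = 0"
    proof (rule "3.IH"(2)[OF _ nd])
      fix c' :: "'a list" assume "\<not> distinct_adj c'"
      then show "f (x # c') = 0"
        by (intro "3.prems"(1)) (auto simp: distinct_adj_Cons)
    qed
    moreover have "f (y # c) = 0" using nd "3.prems"(1) by blast
    ultimately show ?thesis by simp
  qed
qed auto

lemma prism_diff:
  "prism g y (\<lambda>c. f c - f' c) c = prism g y f c - prism g y f' c"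
  by (induction c arbitrary: f f' y) auto

text \<open>The point \<open>y\<close> enters \<open>prism\<close> only through its first term; this
  moves the base from \<open>y\<close> to \<open>x\<close> in the induction for
  \<open>prism_coboundary\<close>.\<close>

lemma prism_base_point:
  "prism g y f c - prism g x f c = f (g y # map g c) - f (g x # map g c)"
  by (cases c) auto

text \<open>The homotopy identity: \<open>prism\<close> contracts the augmented complex, so every
  cycle bounds its own cone.\<close>

lemma prism_coboundary:
  "prism g y (coboundary f) c = f c - coboundary (prism g y f) c"
proof (induction c arbitrary: f y)
  case (Cons x c)
  have "coboundary (\<lambda>c'. f (g y # g x # map g c')) c
      = coboundary (\<lambda>c'. f (g y # g x # c')) (map g c)"
    by (rule coboundary_map)
  then show ?case
    using Cons.IH[of x "\<lambda>c'. f (x # c')"] prism_base_point[of g y f c x]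
    by (simp add: prism_diff coboundary_diff)
qed simp

lemma norm_diff_diff:
  "norm_diff w p k (\<lambda>c. f c - g c) c = norm_diff w p k f c - norm_diff w p k g c"
  by (auto simp: norm_diff_def sum_subtractf)

lemma coboundary_norm_diff:
  "coboundary (norm_diff w p k f) c = norm_diff w p k (coboundary f) c"
proof -
  consider "k = 0" | "odd k" | "k \<noteq> 0" "even k" by blast
  then show ?thesis
  proof cases
    case 1
    then show ?thesis by (simp add: norm_diff_def[abs_def])
  next
    case 2
    then have "norm_diff w p k f = (\<lambda>c. f (map w c) - f c)" for f :: "'a list \<Rightarrow> int"
      by (auto simp: norm_diff_def fun_eq_iff)
    then show ?thesis by (simp add: coboundary_diff coboundary_map)
  next
    case 3
    then have "norm_diff w p k f = (\<lambda>c. \<Sum>s<p. f (map (w ^^ s) c))" for f :: "'a list \<Rightarrow> int"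
      by (auto simp: norm_diff_def fun_eq_iff)
    then show ?thesis by (simp add: coboundary_sum coboundary_map)
  qed
qed

lemma norm_diff_cong_mod:
  assumes "[f c = g c] (mod m)" "\<And>s. [f (map (w ^^ s) c) = g (map (w ^^ s) c)] (mod m)"
  shows "[norm_diff w p k f c = norm_diff w p k g c] (mod m)"
  using assms(1) assms(2)[of 1] assms(2)
  by (auto simp: norm_diff_def intro: cong_diff cong_sum)

lemma sum_orbit_telescope:
  assumes "w ^^ p = id"
  shows "(\<Sum>s<p. f (map (w ^^ Suc s) c)) = (\<Sum>s<p. f (map (w ^^ s) c) :: int)"
proof -
  have "(\<Sum>s<p. f (map (w ^^ Suc s) c) - f (map (w ^^ s) c)) = f (map (w ^^ p) c) - f (map (w ^^ 0) c)"
    by (rule sum_lessThan_telescope)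
  also have "\<dots> = 0" using assms by simp
  finally show ?thesis by (simp add: sum_subtractf)
qed

text \<open>With N the orbit sum, these are the relations N(w - 1) = (w - 1)N = 0, both by
  telescoping around an orbit.\<close>

lemma norm_diff_norm_diff:
  assumes "w ^^ p = id" "k > 0"
  shows "norm_diff w p k (norm_diff w p (Suc k) f) c = 0"
proof -
  have *: "map ((w ^^ s) \<circ> w) c = map (w ^^ Suc s) c" "map (w \<circ> (w ^^ s)) c = map (w ^^ Suc s) c" for s
    by (simp_all add: funpow_swap1 o_def)
  show ?thesis
    using assms(2) sum_orbit_telescope[OF assms(1), of f c]
    by (auto simp: norm_diff_def sum_subtractf * simp del: funpow.simps)
qed

section \<open>Equivariant labellings\<close>

definition nonzero_vectors :: "nat \<Rightarrow> nat set \<Rightarrow> (nat \<Rightarrow> nat) set" where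
  "nonzero_vectors p V = {X. X \<noteq> (\<lambda>_. 0) \<and> (\<forall>i. X i \<le> p) \<and> (\<forall>i. i \<notin> V \<longrightarrow> X i = 0)}"

definition extends :: "(nat \<Rightarrow> nat) \<Rightarrow> (nat \<Rightarrow> nat) \<Rightarrow> bool" where
  "extends X Y \<longleftrightarrow> (\<forall>i. X i \<noteq> 0 \<longrightarrow> Y i = X i)"

text \<open>Multiplication by \<open>\<omega>\<close>; values above \<open>p\<close> are fixed so that the \<open>p\<close>-th power is the identity
  on all of \<open>nat\<close>.\<close>

definition rot :: "nat \<Rightarrow> nat \<Rightarrow> nat" where
  "rot p i = (if i = 0 \<or> i > p then i else if i = p then 1 else i + 1)"

definition rotv :: "nat \<Rightarrow> (nat \<Rightarrow> nat) \<Rightarrow> nat \<Rightarrow> nat" where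
  "rotv p X = rot p \<circ> X"

text \<open>Evaluation of a cochain on a chain \<open>e\<close> of the order complex built by coning off, one
  coordinate at a time, the images of the previous chain under \<open>w - 1\<close> and \<open>1 + w + \<dots> + w\<^bsup>p-1\<^esup>\<close>.\<close>

primrec fundamental_chain :: "nat \<Rightarrow> nat list \<Rightarrow> ((nat \<Rightarrow> nat) list \<Rightarrow> int) \<Rightarrow> int" where
  "fundamental_chain p [] f = f []"
| "fundamental_chain p (v # vs) f =
     fundamental_chain p vs
       (norm_diff (rotv p) p (length vs) (prism (\<lambda>X. X(v := 1)) (\<lambda>_. 0) f))"

lemma rot_mod: "1 \<le> i \<Longrightarrow> i \<le> p \<Longrightarrow> rot p i = i mod p + 1"
  by (cases "i = p") (auto simp: rot_def)

lemma rot_pow_mod: "1 \<le> i \<Longrightarrow> i \<le> p \<Longrightarrow> (rot p ^^ s) i = (i - 1 + s) mod p + 1"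
proof (induction s)
  case (Suc s)
  then have "p > 0" by auto
  then have "(i - 1 + s) mod p + 1 \<le> p" by (simp add: Suc_leI)
  then show ?case using Suc by (simp add: rot_mod mod_simps)
qed auto

lemma rot_pow_id: "rot p ^^ p = id"
proof
  fix i
  show "(rot p ^^ p) i = id i"
  proof (cases "1 \<le> i \<and> i \<le> p")
    case True
    then have "i - 1 < p" by auto
    then have "(i - 1 + p) mod p = i - 1" by (simp only: mod_add_self2 mod_less)
    with True show ?thesis by (simp only: rot_pow_mod) simp
  next
    case False
    then have "rot p i = i" by (auto simp: rot_def)
    then have "(rot p ^^ s) i = i" for s by (induction s) auto
    then show ?thesis by simp
  qed
qed

lemma rotv_pow: "(rotv p ^^ s) X = (rot p ^^ s) \<circ> X"
  by (induction s) (auto simp: rotv_def)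

lemma rotv_pow_id: "rotv p ^^ p = id"
  by (auto simp: fun_eq_iff rotv_pow rot_pow_id)

lemma rot_inj: "rot p i = rot p j \<longleftrightarrow> i = j"
  by (auto simp: rot_def split: if_splits)

lemma rot_eq_0 [simp]: "rot p i = 0 \<longleftrightarrow> i = 0"
  by (auto simp: rot_def)

lemma rotv_in_nonzero_vectors: "X \<in> nonzero_vectors p V \<Longrightarrow> rotv p X \<in> nonzero_vectors p V"
  by (auto simp: nonzero_vectors_def rotv_def fun_eq_iff rot_def)

lemma rotv_pow_in_nonzero_vectors:
  "X \<in> nonzero_vectors p V \<Longrightarrow> (rotv p ^^ s) X \<in> nonzero_vectors p V"
  by (induction s) (auto simp: rotv_in_nonzero_vectors)

lemma extends_rotv: "extends X Y \<Longrightarrow> extends (rotv p X) (rotv p Y)"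
  by (auto simp: extends_def rotv_def)

lemma extends_rotv_pow: "extends X Y \<Longrightarrow> extends ((rotv p ^^ s) X) ((rotv p ^^ s) Y)"
  by (induction s) (auto simp: extends_rotv)

lemma fundamental_chain_diff:
  "fundamental_chain p vs (\<lambda>c. f c - g c) = fundamental_chain p vs f - fundamental_chain p vs g"
  by (induction vs arbitrary: f g) (auto simp: prism_diff[abs_def] norm_diff_diff[abs_def])

lemma fundamental_chain_zero: "fundamental_chain p vs (\<lambda>c. 0) = 0"
  using fundamental_chain_diff[of p vs "\<lambda>c. 0" "\<lambda>c. 0"] by simp

text \<open>Write e_n for the chain on n coordinates and D_n for the operators. Since e_(n+1) is the
  cone over D_n e_n, its boundary is D_n e_n as soon as that is a cycle, and the boundary of D_n e_n
  is D_n D_(n-1) e_(n-1) = 0.\<close>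

lemma fundamental_chain_coboundary:
  "fundamental_chain p (v # vs) (coboundary f)
   = fundamental_chain p vs (norm_diff (rotv p) p (length vs) f)"
proof (induction vs arbitrary: v f)
  case Nil
  then show ?case by (simp add: norm_diff_def)
next
  case (Cons u us)
  define D where "D = norm_diff (rotv p) p"
  define h where "h = prism (\<lambda>X. X(v := 1)) (\<lambda>_. 0) f"
  have "prism (\<lambda>X. X(v := 1)) (\<lambda>_. 0) (coboundary f) = (\<lambda>c. f c - coboundary h c)"
    by (simp add: fun_eq_iff prism_coboundary h_def)
  then have "fundamental_chain p (v # u # us) (coboundary f)
     = fundamental_chain p (u # us) (D (Suc (length us)) (\<lambda>c. f c - coboundary h c))"
    by (simp add: D_def)
  also have "D (Suc (length us)) (\<lambda>c. f c - coboundary h c)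
     = (\<lambda>c. D (Suc (length us)) f c - coboundary (D (Suc (length us)) h) c)"
    by (simp add: fun_eq_iff D_def norm_diff_diff coboundary_norm_diff)
  also have "fundamental_chain p (u # us) \<dots> = fundamental_chain p (u # us) (D (Suc (length us)) f)
     - fundamental_chain p (u # us) (coboundary (D (Suc (length us)) h))"
    by (rule fundamental_chain_diff)
  also have "fundamental_chain p (u # us) (coboundary (D (Suc (length us)) h))
     = fundamental_chain p us (D (length us) (D (Suc (length us)) h))"
    unfolding D_def by (rule Cons.IH)
  also have "\<dots> = 0"
  \<comment> \<open>For \<open>us = []\<close> the outer operator is the augmentation, and
    \<open>D 1 h\<close> vanishes at the empty list because mapping leaves that list
    unchanged.\<close>
  proof (cases "us = []")
    case True
    then show ?thesis by (simp add: D_def norm_diff_def)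
  next
    case False
    then have "D (length us) (D (Suc (length us)) h) = (\<lambda>c. 0)"
      unfolding D_def by (intro ext norm_diff_norm_diff rotv_pow_id) auto
    then show ?thesis by (simp add: fundamental_chain_zero)
  qed
  finally show ?case by (simp add: D_def)
qed

section \<open>Chains of vectors\<close>

definition vector_chain :: "nat \<Rightarrow> nat set \<Rightarrow> (nat \<Rightarrow> nat) list \<Rightarrow> bool" where
  "vector_chain p V c \<longleftrightarrow> set c \<subseteq> nonzero_vectors p V \<and> sorted_wrt extends c"

text \<open>Setting a coordinate outside \<open>V\<close> to 1 extends a vector over
  \<open>V\<close>, so every list at which \<open>prism\<close> evaluates \<open>f\<close> is again
  a chain, now over \<open>insert v V\<close>.\<close>

lemma prism_cong_mod:
  assumes "\<And>c'. length c' = Suc (length c) \<Longrightarrow> vector_chain p (insert v V) c' \<Longrightarrow>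
      (\<forall>x\<in>set c'. extends y x) \<Longrightarrow> [f c' = f' c'] (mod m)"
    and "vector_chain p V c" "\<forall>x\<in>set c. extends y x" "v \<notin> V"
    and "\<forall>i. y i \<le> p" "\<forall>i. i \<notin> V \<longrightarrow> y i = 0" "p \<ge> 1"
  shows "[prism (\<lambda>X. X(v := 1)) y f c = prism (\<lambda>X. X(v := 1)) y f' c] (mod m)"
  using assms
proof (induction c arbitrary: f f' y)
  case Nil
  have "[f [y(v := 1)] = f' [y(v := 1)]] (mod m)"
    using Nil.prems(3-)
    by (intro Nil.prems(1)) (auto simp: vector_chain_def nonzero_vectors_def extends_def fun_eq_iff)
  then show ?case by (simp only: prism.simps)
next
  case (Cons x c)
  let ?g = "\<lambda>X :: nat \<Rightarrow> nat. X(v := 1)"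
  have ext_g: "extends (?g X) (?g Y)" if "extends X Y" for X Y
    using that by (auto simp: extends_def)
  have g_in: "?g X \<in> nonzero_vectors p (insert v V)"
    if "\<forall>i. X i \<le> p" "\<forall>i. i \<notin> V \<longrightarrow> X i = 0" for X
    using that \<open>p \<ge> 1\<close> by (auto simp: nonzero_vectors_def fun_eq_iff)
  have x: "x \<in> nonzero_vectors p V" "\<forall>z\<in>set c. extends x z" "extends y x"
    and c: "vector_chain p V c"
    using Cons.prems by (auto simp: vector_chain_def)
  have ext_gy: "extends y (?g X)" if "extends y X" for X
    using that Cons.prems(4,6) by (auto simp: extends_def)
  have "[f (map ?g (y # x # c)) = f' (map ?g (y # x # c))] (mod m)"
  proof (rule Cons.prems(1))
    show "vector_chain p (insert v V) (map ?g (y # x # c))"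
      unfolding vector_chain_def
    proof
      have "\<forall>X\<in>set (y # x # c). (\<forall>i. X i \<le> p) \<and> (\<forall>i. i \<notin> V \<longrightarrow> X i = 0)"
        using Cons.prems(2,5,6) by (auto simp: vector_chain_def nonzero_vectors_def)
      then show "set (map ?g (y # x # c)) \<subseteq> nonzero_vectors p (insert v V)"
        using g_in by (simp only: set_map) blast
      have "sorted_wrt extends (y # x # c)"
        using Cons.prems(2,3) by (auto simp: vector_chain_def)
      then show "sorted_wrt extends (map ?g (y # x # c))"
        unfolding sorted_wrt_map by (rule sorted_wrt_mono_rel[rotated]) (rule ext_g)
    qed
    show "\<forall>z\<in>set (map ?g (y # x # c)). extends y z"
      unfolding set_map using Cons.prems(3) by (auto intro!: ext_gy[unfolded One_nat_def] simp: extends_def[of y y])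
  qed simp
  moreover have "[prism ?g x (\<lambda>c'. f (x # c')) c = prism ?g x (\<lambda>c'. f' (x # c')) c] (mod m)"
  proof (rule Cons.IH)
    fix c' assume c': "length c' = Suc (length c)" "vector_chain p (insert v V) c'"
      "\<forall>z\<in>set c'. extends x z"
    have "x \<in> nonzero_vectors p (insert v V)" using x(1) by (auto simp: nonzero_vectors_def)
    moreover have "extends y z" if "extends x z" for z
      using that x(3) by (auto simp: extends_def)
    ultimately show "[f (x # c') = f' (x # c')] (mod m)"
      using c' x by (intro Cons.prems(1)) (auto simp: vector_chain_def)
  qed (use x c Cons.prems in \<open>auto simp: nonzero_vectors_def\<close>)
  ultimately show ?case unfolding prism.simps list.map by (rule cong_diff)
qed

lemma vector_chain_rotv_pow:
  "vector_chain p V c \<Longrightarrow> vector_chain p V (map (rotv p ^^ s) c)"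
  by (auto simp: vector_chain_def rotv_pow_in_nonzero_vectors sorted_wrt_map subset_iff
      intro: sorted_wrt_mono_rel[of _ extends] extends_rotv_pow)

text \<open>The fundamental chain is a combination of vector chains, so only the values on those
  matter.\<close>

lemma fundamental_chain_cong_mod:
  assumes "\<And>c. length c = length vs \<Longrightarrow> vector_chain p (set vs) c \<Longrightarrow> [f c = g c] (mod m)"
    and "distinct vs" "p \<ge> 1"
  shows "[fundamental_chain p vs f = fundamental_chain p vs g] (mod m)"
  using assms
proof (induction vs arbitrary: f g)
  case Nil
  then show ?case by (auto simp: vector_chain_def)
next
  case (Cons v vs)
  have prism: "[prism (\<lambda>X. X(v := 1)) (\<lambda>_. 0) f c = prism (\<lambda>X. X(v := 1)) (\<lambda>_. 0) g c] (mod m)"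
    if "length c = length vs" "vector_chain p (set vs) c" for c
  proof (rule prism_cong_mod[where V = "set vs" and p = p])
    fix c' assume "length c' = Suc (length c)" "vector_chain p (insert v (set vs)) c'"
    then show "[f c' = g c'] (mod m)" using that by (intro Cons.prems(1)) simp_all
  qed (use Cons.prems that in \<open>auto simp: extends_def\<close>)
  show ?case
    unfolding fundamental_chain.simps
    using Cons.prems(2,3)
    by (intro Cons.IH norm_diff_cong_mod prism vector_chain_rotv_pow) simp_all
qed

section \<open>Equivariant cochains over a cyclic group\<close>

text \<open>Labels are residues 0 to p - 1, whereas nonzero entries of vectors run from 1 to p.
  Numbers from p on are fixed, which makes the p-th power the identity everywhere.\<close>

definition cyc :: "nat \<Rightarrow> nat \<Rightarrow> nat" where
  "cyc p i = (if i < p then Suc i mod p else i)"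

lemma cyc_pow: "i < p \<Longrightarrow> (cyc p ^^ s) i = (i + s) mod p"
  by (induction s) (auto simp: cyc_def mod_simps)

lemma cyc_pow_id: "cyc p ^^ p = id"
proof
  fix i
  show "(cyc p ^^ p) i = id i"
  proof (cases "i < p")
    case False
    then have "(cyc p ^^ s) i = i" for s by (induction s) (auto simp: cyc_def)
    then show ?thesis by simp
  qed (simp add: cyc_pow)
qed

lemma map_cyc_pow_add: "map (cyc p ^^ s) (map (cyc p) c) = map (cyc p ^^ Suc s) c"
  by (simp add: funpow_swap1)

text \<open>Tuples over a cyclic group form a free orbit set, so on functions of tuples the kernel of
  each of the operators \<open>w - 1\<close> and \<open>1 + w + \<dots> + w\<^bsup>p-1\<^esup>\<close> is the image of the other. The solution
  below is normalised by the first entry of the tuple.\<close>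

lemma norm_diff_preimage:
  assumes "p \<ge> 1" "k \<ge> 1"
    and norm: "\<And>c. \<not> distinct_adj c \<Longrightarrow> \<gamma> c = 0"
    and ker: "\<And>c. length c = k \<Longrightarrow> set c \<subseteq> {..<p} \<Longrightarrow>
               [norm_diff (cyc p) p (Suc k) \<gamma> c = 0] (mod int p)"
  obtains \<beta> where "\<And>c. \<not> distinct_adj c \<Longrightarrow> \<beta> c = (0::int)"
    and "\<And>c. length c = k \<Longrightarrow> set c \<subseteq> {..<p} \<Longrightarrow>
               [norm_diff (cyc p) p k \<beta> c = \<gamma> c] (mod int p)"
proof (cases "odd k")
  case True
  \<comment> \<open>The orbit of \<open>c\<close> has one member with head 0, reached after
    \<open>p - hd c\<close> steps. The sum of \<open>\<gamma>\<close> runs along the orbit from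
    there up to, but excluding, \<open>c\<close>, so that one further step adds
    \<open>\<gamma> c\<close>.\<close>
  define \<beta> where "\<beta> c = (\<Sum>j<hd c. \<gamma> (map (cyc p ^^ (p - hd c + j)) c))" for c
  have nd: "\<not> distinct_adj (map g c)" if "\<not> distinct_adj c" for g :: "nat \<Rightarrow> nat" and c
    using that distinct_adj_mapD by blast
  show ?thesis
  proof
    show "\<beta> c = 0" if "\<not> distinct_adj c" for c
      unfolding \<beta>_def by (intro sum.neutral ballI norm nd that)
    fix c assume c: "length c = k" "set c \<subseteq> {..<p}"
    from c \<open>k \<ge> 1\<close> obtain i c' where [simp]: "c = i # c'" by (cases c) auto
    with c have i: "i < p" by simp
    have ker': "[(\<Sum>s<p. \<gamma> (map (cyc p ^^ s) c)) = 0] (mod int p)"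
      using ker[OF c] True by (simp add: norm_diff_def)
    have "[\<beta> (map (cyc p) c) - \<beta> c = \<gamma> c] (mod int p)"
    \<comment> \<open>From head p - 1 the next step returns to head 0, where the sum is empty; here
      the vanishing of the full orbit sum modulo p is needed.\<close>
    proof (cases "Suc i = p")
      case True
      then have p: "p = Suc i" by simp
      have "\<beta> (map (cyc p) c) = 0" using True by (simp add: \<beta>_def cyc_def)
      moreover have "\<beta> c = (\<Sum>s<i. \<gamma> (map (cyc p ^^ Suc s) c))"
        unfolding \<beta>_def using p by simp
      moreover have "(\<Sum>s<p. \<gamma> (map (cyc p ^^ s) c)) = \<gamma> c + (\<Sum>s<i. \<gamma> (map (cyc p ^^ Suc s) c))"
        by (subst p, subst sum.lessThan_Suc_shift) simp
      ultimately show ?thesis using ker'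
        by (simp add: cong_iff_dvd_diff dvd_diff_commute)
    next
      case False
      with i have i': "Suc i < p" by simp
      have "\<beta> (map (cyc p) c) = (\<Sum>j<Suc i. \<gamma> (map (cyc p ^^ (p - Suc i + j)) (map (cyc p) c)))"
        unfolding \<beta>_def using i' by (simp add: cyc_def)
      also have "\<dots> = (\<Sum>j<Suc i. \<gamma> (map (cyc p ^^ (p - i + j)) c))"
      proof (rule sum.cong[OF refl], unfold map_cyc_pow_add)
        fix j
        have "Suc (p - Suc i + j) = p - i + j" using i' by simp
        then show "\<gamma> (map (cyc p ^^ Suc (p - Suc i + j)) c) = \<gamma> (map (cyc p ^^ (p - i + j)) c)"
          by (simp only:)
      qed
      also have "\<dots> = \<beta> c + \<gamma> (map (cyc p ^^ (p - i + i)) c)"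
        by (simp add: \<beta>_def)
      also have "p - i + i = p" using i by simp
      finally show ?thesis by (simp add: cyc_pow_id)
    qed
    then show "[norm_diff (cyc p) p k \<beta> c = \<gamma> c] (mod int p)"
      using \<open>odd k\<close> \<open>k \<ge> 1\<close> by (simp add: norm_diff_def)
  qed
next
  case False
  \<comment> \<open>The orbit sum of \<open>\<beta>\<close> keeps the single member with head 0, and
    \<open>\<gamma>\<close> is constant on orbits modulo p.\<close>
  define \<beta> where "\<beta> c = (if hd c = 0 then \<gamma> c else 0)" for c
  show ?thesis
  proof
    show "\<beta> c = 0" if "\<not> distinct_adj c" for c
      using norm[OF that] by (simp add: \<beta>_def)
    fix c assume c: "length c = k" "set c \<subseteq> {..<p}"
    from c \<open>k \<ge> 1\<close> obtain i c' where ci: "c = i # c'" by (cases c) auto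
    with c have i: "i < p" by simp
    have inv: "[\<gamma> (map (cyc p ^^ s) c) = \<gamma> c] (mod int p)" for s
    proof (induction s)
      case (Suc s)
      have "[\<gamma> (map (cyc p) (map (cyc p ^^ s) c)) - \<gamma> (map (cyc p ^^ s) c) = 0] (mod int p)"
      proof -
        have "set (map (cyc p ^^ s) c) \<subseteq> {..<p}"
          using c \<open>p \<ge> 1\<close> by (auto simp: cyc_pow subset_iff)
        with ker[of "map (cyc p ^^ s) c"] False c show ?thesis
          by (simp add: norm_diff_def)
      qed
      then have "[\<gamma> (map (cyc p ^^ Suc s) c) = \<gamma> (map (cyc p ^^ s) c)] (mod int p)"
        by (simp add: cong_diff_iff_cong_0 comp_def)
      with Suc.IH show ?case by (rule cong_trans[rotated])
    qed simp
    define s0 where "s0 = (p - i) mod p"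
    have s0: "s0 < p" using \<open>p \<ge> 1\<close> by (simp add: s0_def)
    have iff: "(i + s) mod p = 0 \<longleftrightarrow> s = s0" if "s < p" for s
    proof (cases "i = 0")
      case False
      then have "s0 = p - i" using i by (simp add: s0_def)
      moreover have "(i + s) mod p = (if i + s < p then i + s else i + s - p)"
        using i that by (simp add: mod_if le_mod_geq)
      ultimately show ?thesis using False i that by auto
    qed (use that s0_def in auto)
    have "(\<Sum>s<p. \<beta> (map (cyc p ^^ s) c)) = (\<Sum>s<p. if s = s0 then \<gamma> (map (cyc p ^^ s) c) else 0)"
      by (intro sum.cong refl) (simp add: \<beta>_def ci cyc_pow[OF i] iff)
    also have "\<dots> = \<gamma> (map (cyc p ^^ s0) c)" using s0 by simp
    finally show "[norm_diff (cyc p) p k \<beta> c = \<gamma> c] (mod int p)"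
      using False \<open>k \<ge> 1\<close> inv[of s0] by (simp add: norm_diff_def)
  qed
qed

text \<open>Induction along the periodic resolution. With k coordinates, the kernel condition allows
  solving D_k \<beta> = \<gamma>, and the coboundary of \<open>\<beta>\<close> is the next cochain.
  Its value on e_(k+1) is that of D_k \<beta>, hence of \<open>\<gamma>\<close>, on e_k, so it stays
  1. The cocycle condition on \<open>\<gamma>\<close> yields the next kernel condition.\<close>

lemma equivariant_labelling_cochain:
  assumes "p \<ge> 1" "distinct vs" "vs \<noteq> []"
    and ind: "\<And>X. X \<in> nonzero_vectors p (set vs) \<Longrightarrow> ind X < p \<and> ind (rotv p X) = Suc (ind X) mod p"
  shows "\<exists>\<gamma>. (\<forall>c. \<not> distinct_adj c \<longrightarrow> \<gamma> c = (0::int)) \<and>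
     (\<forall>c. length c = Suc (length vs) \<longrightarrow> set c \<subseteq> {..<p} \<longrightarrow> [coboundary \<gamma> c = 0] (mod int p)) \<and>
     (\<forall>c. length c = length vs \<longrightarrow> set c \<subseteq> {..<p} \<longrightarrow>
        [norm_diff (cyc p) p (Suc (length vs)) \<gamma> c = 0] (mod int p)) \<and>
     [fundamental_chain p vs (\<lambda>c. \<gamma> (map ind c)) = 1] (mod int p)"
  using assms(2-)
proof (induction vs)
  case (Cons v vs)
  show ?case
  proof (cases "vs = []")
    case True
    \<comment> \<open>In degree 0 the generator is the constant 1; its orbit sum is p, which is 0
      modulo p.\<close>
    define \<gamma> :: "nat list \<Rightarrow> int" where "\<gamma> c = (if length c = 1 then 1 else 0)" for c
    have \<gamma>_one: "\<gamma> [x] = 1" "length c = Suc 0 \<Longrightarrow> \<gamma> c = 1" "length c = Suc 0 \<Longrightarrow> \<gamma> (map g c) = 1" for x c g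
      by (simp_all add: \<gamma>_def)
    have "[coboundary \<gamma> c = 0] (mod int p)" if c: "length c = 2" for c
    proof -
      from c obtain a b where "c = [a, b]"
        by (metis (no_types, lifting) One_nat_def Suc_1 length_0_conv length_Suc_conv)
      then show ?thesis by (simp add: \<gamma>_def)
    qed
    moreover have "\<gamma> c = 0" if "\<not> distinct_adj c" for c
      using that by (cases c rule: remdups_adj.cases) (auto simp: \<gamma>_def)
    ultimately show ?thesis
      using True by (intro exI[of _ \<gamma>]) (auto simp: norm_diff_def cong_0_iff \<gamma>_one)
  next
    case False
    let ?k = "length vs"
    have sub: "nonzero_vectors p (set vs) \<subseteq> nonzero_vectors p (set (v # vs))"
      by (auto simp: nonzero_vectors_def)
    obtain \<gamma> where norm: "\<And>c. \<not> distinct_adj c \<Longrightarrow> \<gamma> c = (0::int)"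
      and cocycle: "\<And>c. length c = Suc ?k \<Longrightarrow> set c \<subseteq> {..<p} \<Longrightarrow> [coboundary \<gamma> c = 0] (mod int p)"
      and ker: "\<And>c. length c = ?k \<Longrightarrow> set c \<subseteq> {..<p} \<Longrightarrow>
        [norm_diff (cyc p) p (Suc ?k) \<gamma> c = 0] (mod int p)"
      and one: "[fundamental_chain p vs (\<lambda>c. \<gamma> (map ind c)) = 1] (mod int p)"
    proof -
      have "\<And>X. X \<in> nonzero_vectors p (set vs) \<Longrightarrow> ind X < p \<and> ind (rotv p X) = Suc (ind X) mod p"
        using Cons.prems(3) sub by blast
      then show ?thesis using Cons.IH Cons.prems(1) False that by auto
    qed
    have "?k \<ge> 1" using False by (simp add: Suc_leI)
    from norm_diff_preimage[OF \<open>p \<ge> 1\<close> this norm ker]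
    obtain \<beta> where \<beta>_norm: "\<And>c. \<not> distinct_adj c \<Longrightarrow> \<beta> c = (0::int)"
      and \<beta>: "\<And>c. length c = ?k \<Longrightarrow> set c \<subseteq> {..<p} \<Longrightarrow>
               [norm_diff (cyc p) p ?k \<beta> c = \<gamma> c] (mod int p)"
      by blast
    show ?thesis
    proof (intro exI[of _ "coboundary \<beta>"] conjI allI impI)
      show "coboundary \<beta> c = 0" if "\<not> distinct_adj c" for c
        using \<beta>_norm that by (rule coboundary_not_distinct_adj)
      show "[coboundary (coboundary \<beta>) c = 0] (mod int p)" for c
        by (simp add: coboundary_coboundary)
      show "[norm_diff (cyc p) p (Suc (length (v # vs))) (coboundary \<beta>) c = 0] (mod int p)"
        if c: "length c = length (v # vs)" "set c \<subseteq> {..<p}" for c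
      proof -
        \<comment> \<open>From index 1 on the operators have period 2, so the same operator that was
          inverted to obtain \<open>\<beta>\<close> appears here.\<close>
        have "norm_diff (cyc p) p (Suc (length (v # vs))) = norm_diff (cyc p) p ?k"
          using False by (auto simp: norm_diff_def fun_eq_iff)
        then have "norm_diff (cyc p) p (Suc (length (v # vs))) (coboundary \<beta>) c
            = coboundary (norm_diff (cyc p) p ?k \<beta>) c"
          by (simp add: coboundary_norm_diff)
        also have "[\<dots> = coboundary \<gamma> c] (mod int p)"
          using c by (intro coboundary_cong_mod \<beta>) auto
        also have "[coboundary \<gamma> c = 0] (mod int p)"
          using c by (intro cocycle) auto
        finally show ?thesis .
      qed
      have "(\<lambda>c. coboundary \<beta> (map ind c)) = coboundary (\<lambda>c. \<beta> (map ind c))"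
        by (simp add: fun_eq_iff coboundary_map)
      then have "fundamental_chain p (v # vs) (\<lambda>c. coboundary \<beta> (map ind c))
          = fundamental_chain p vs (norm_diff (rotv p) p ?k (\<lambda>c. \<beta> (map ind c)))"
        by (simp only: fundamental_chain_coboundary)
      also have "[\<dots> = fundamental_chain p vs (\<lambda>c. \<gamma> (map ind c))] (mod int p)"
      proof (rule fundamental_chain_cong_mod)
        fix c assume c: "length c = length vs" "vector_chain p (set vs) c"
        have Q: "X \<in> nonzero_vectors p (set (v # vs))" if "X \<in> set c" for X
          using that c sub by (auto simp: vector_chain_def)
        have ind_pow: "ind ((rotv p ^^ s) X) = (cyc p ^^ s) (ind X)" if "X \<in> set c" for X s
        proof (induction s)
          case (Suc s)
          have "(rotv p ^^ s) X \<in> nonzero_vectors p (set (v # vs))"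
            using Q[OF that] by (rule rotv_pow_in_nonzero_vectors)
          then show ?case using Suc Cons.prems(3)[of "(rotv p ^^ s) X"] by (simp add: cyc_def)
        qed simp
        have map_pow: "map (ind \<circ> (rotv p ^^ s)) c = map ((cyc p ^^ s) \<circ> ind) c" for s
          using ind_pow by simp
        have "norm_diff (rotv p) p ?k (\<lambda>c. \<beta> (map ind c)) c = norm_diff (cyc p) p ?k \<beta> (map ind c)"
          using map_pow[of 1] by (simp add: norm_diff_def map_pow del: map_eq_conv)
        also have "[\<dots> = \<gamma> (map ind c)] (mod int p)"
          using c Q Cons.prems(3) by (intro \<beta>) auto
        finally show "[norm_diff (rotv p) p ?k (\<lambda>c. \<beta> (map ind c)) c = \<gamma> (map ind c)] (mod int p)" .
      qed (use Cons.prems \<open>p \<ge> 1\<close> in auto)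
      also note one
      finally show "[fundamental_chain p (v # vs) (\<lambda>c. coboundary \<beta> (map ind c)) = 1] (mod int p)" .
    qed
  qed
qed simp

text \<open>If every chain of \<open>card S\<close> vectors had two equal consecutive labels, the
  normalised cochain would vanish on the whole fundamental chain, against its value 1 modulo
  p.\<close>

lemma equivariant_labelling_chain:
  assumes "p \<ge> 2" "finite S" "S \<noteq> {}"
    and ind: "\<And>X. X \<in> nonzero_vectors p S \<Longrightarrow> ind X < p \<and> ind (rotv p X) = Suc (ind X) mod p"
  obtains c where "length c = card S" "set c \<subseteq> nonzero_vectors p S" "sorted_wrt extends c"
    "distinct_adj (map ind c)"
proof -
  obtain vs where vs: "set vs = S" "distinct vs" using finite_distinct_list[OF \<open>finite S\<close>] by blast
  then have len: "length vs = card S" using distinct_card by metis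
  obtain \<gamma> where norm: "\<And>c. \<not> distinct_adj c \<Longrightarrow> \<gamma> c = (0::int)"
    and one: "[fundamental_chain p vs (\<lambda>c. \<gamma> (map ind c)) = 1] (mod int p)"
    using equivariant_labelling_cochain[of p vs ind] assms vs by auto
  show ?thesis
  proof (rule ccontr)
    assume none: "\<not> thesis"
    have "[fundamental_chain p vs (\<lambda>c. \<gamma> (map ind c)) = fundamental_chain p vs (\<lambda>c. 0)] (mod int p)"
    proof (rule fundamental_chain_cong_mod)
      fix c assume "length c = length vs" "vector_chain p (set vs) c"
      then have "\<not> distinct_adj (map ind c)"
        using none that[of c] vs len by (auto simp: vector_chain_def)
      then show "[\<gamma> (map ind c) = 0] (mod int p)" by (simp add: norm)
    qed (use vs \<open>p \<ge> 2\<close> in auto)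
    then have "[1 = 0] (mod int p)"
      using one by (metis cong_sym cong_trans fundamental_chain_zero)
    then show False using \<open>p \<ge> 2\<close> by (simp add: cong_0_iff)
  qed
qed

section \<open>The alternation bound for Kneser hypergraphs\<close>

definition support :: "(nat \<Rightarrow> nat) \<Rightarrow> nat set" where
  "support X = {i. X i \<noteq> 0}"

definition alternating :: "(nat \<Rightarrow> nat) \<Rightarrow> nat set \<Rightarrow> bool" where
  "alternating X B \<longleftrightarrow> (\<forall>i\<in>B. \<forall>j\<in>B. i < j \<longrightarrow> {i<..<j} \<inter> B = {} \<longrightarrow> X i \<noteq> X j)"

definition alternation :: "(nat \<Rightarrow> nat) \<Rightarrow> nat" where
  "alternation X = Max (card ` {B. B \<subseteq> support X \<and> alternating X B})"

text \<open>Alternation is required on the whole support, so that \<open>card (support Z)\<close> is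
  the quantity to maximise.\<close>

definition admissible :: "nat \<Rightarrow> nat set \<Rightarrow> nat set set \<Rightarrow> (nat \<Rightarrow> nat) \<Rightarrow> bool" where
  "admissible r S E Z \<longleftrightarrow> (\<forall>i. Z i \<le> r) \<and> support Z \<subseteq> S \<and> alternating Z (support Z) \<and>
     (\<forall>i\<in>{1..r}. \<forall>e\<in>E. \<not> e \<subseteq> {j. Z j = i})"

definition kneser_proper :: "nat \<Rightarrow> 'a set set \<Rightarrow> ('a set \<Rightarrow> nat) \<Rightarrow> bool" where
  "kneser_proper r E col \<longleftrightarrow>
     \<not> (\<exists>F\<subseteq>E. card F = r \<and> pairwise disjnt F \<and> (\<exists>a. \<forall>e\<in>F. col e = a))"

section \<open>Alternation of vectors\<close>

lemma alternating_cong: "(\<And>i. i \<in> B \<Longrightarrow> X i = Y i) \<Longrightarrow> alternating X B \<longleftrightarrow> alternating Y B"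
  by (simp add: alternating_def)

lemma alternating_insert_less:
  assumes "alternating X B" "finite B" "\<forall>b\<in>B. i < b" "B \<noteq> {} \<Longrightarrow> X i \<noteq> X (Min B)"
  shows "alternating X (insert i B)"
  unfolding alternating_def
proof (intro ballI impI)
  fix a b assume ab: "a \<in> insert i B" "b \<in> insert i B" "a < b" "{a<..<b} \<inter> insert i B = {}"
  show "X a \<noteq> X b"
  proof (cases "a = i")
    case True
    with ab have "b \<in> B" by auto
    then have "Min B \<le> b" "Min B \<in> B" using assms(2) by (simp, intro Min_in) auto
    moreover have "Min B \<notin> {a<..<b}" using ab(4) \<open>Min B \<in> B\<close> by auto
    ultimately have "Min B = b" using True assms(3) by auto
    with True assms(4) \<open>b \<in> B\<close> show ?thesis by auto
  next
    case False
    with ab(1) have "a \<in> B" by simp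
    moreover have "b \<in> B" using ab(2,3) assms(3) \<open>a \<in> B\<close> by auto
    moreover have "{a<..<b} \<inter> B = {}" using ab(4) by auto
    ultimately show ?thesis using ab(3) assms(1) by (simp add: alternating_def)
  qed
qed

lemma finite_alternating_sets: "finite (support X) \<Longrightarrow> finite {B. B \<subseteq> support X \<and> alternating X B}"
  by (rule finite_subset[of _ "Pow (support X)"]) auto

lemma alternation_ge:
  assumes "finite (support X)" "B \<subseteq> support X" "alternating X B"
  shows "card B \<le> alternation X"
  unfolding alternation_def using assms finite_alternating_sets[OF assms(1)] by (intro Max_ge) auto

lemma alternation_witness:
  assumes "finite (support X)"
  obtains B where "B \<subseteq> support X" "alternating X B" "card B = alternation X"
proof -
  have "alternating X {}" by (simp add: alternating_def)
  then have "alternation X \<in> card ` {B. B \<subseteq> support X \<and> alternating X B}"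
    unfolding alternation_def using finite_alternating_sets[OF assms] by (intro Max_in) auto
  then show ?thesis using that by auto
qed

lemma alternation_pos:
  assumes "finite (support X)" "X \<noteq> (\<lambda>_. 0)"
  shows "alternation X \<ge> 1"
proof -
  obtain i where "X i \<noteq> 0" using assms(2) by auto
  then have "card {i} \<le> alternation X"
    by (intro alternation_ge assms) (auto simp: support_def alternating_def)
  then show ?thesis by simp
qed

lemma extends_support: "extends X Y \<Longrightarrow> support X \<subseteq> support Y"
  by (auto simp: extends_def support_def)

lemma alternation_mono:
  assumes "extends X Y" "finite (support Y)"
  shows "alternation X \<le> alternation Y"
proof -
  have sub: "support X \<subseteq> support Y" using assms(1) by (rule extends_support)
  obtain B where B: "B \<subseteq> support X" "alternating X B" "card B = alternation X"
    using alternation_witness finite_subset[OF sub assms(2)] by metis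
  have "alternating Y B"
    using B(1,2) assms(1) alternating_cong[of B X Y] by (force simp: extends_def support_def)
  then show ?thesis using alternation_ge[OF assms(2), of B] B sub by auto
qed

text \<open>If the first nonzero entry changed, an optimal alternating set of \<open>X\<close> could
  be lengthened at the front. This makes the first entry a label that is constant where the
  alternation is.\<close>

lemma alternation_eq_first:
  assumes ext: "extends X Y" and fin: "finite (support Y)" and "X \<noteq> (\<lambda>_. 0)"
    and eq: "alternation X = alternation Y"
  shows "X (Min (support X)) = Y (Min (support Y))"
proof (rule ccontr)
  define a where "a = Min (support X)"
  define b where "b = Min (support Y)"
  assume "X (Min (support X)) \<noteq> Y (Min (support Y))"
  then have ne: "X a \<noteq> Y b" by (simp add: a_def b_def)
  have sub: "support X \<subseteq> support Y" using ext by (rule extends_support)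
  have finX: "finite (support X)" using sub fin by (rule finite_subset)
  have neX: "support X \<noteq> {}" using assms(3) by (auto simp: support_def)
  have agree: "Y i = X i" if "i \<in> support X" for i
    using that ext by (auto simp: extends_def support_def)
  have a: "a \<in> support X" using finX neX by (simp add: a_def)
  have b: "b \<in> support Y" unfolding b_def using fin neX sub by (intro Min_in) auto
  have "b \<le> a" using a sub fin by (auto simp: b_def)
  with ne agree[OF a] have ba: "b < a" by (cases "a = b") auto
  obtain B where B: "B \<subseteq> support X" "alternating X B" "card B = alternation X"
    using alternation_witness finX by metis
  have finB: "finite B" using B(1) finX by (rule finite_subset)
  have "B \<noteq> {}" using alternation_pos[OF finX assms(3)] B(3) by auto
  define m where "m = Min B"
  have m: "m \<in> B" using finB \<open>B \<noteq> {}\<close> by (simp add: m_def)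
  have le: "a \<le> i" if "i \<in> B" for i using that B(1) finX by (auto simp: a_def)
  show False
  \<comment> \<open>If the first element of \<open>B\<close> carries the leading value of
    \<open>Y\<close>, it differs from the leading value of \<open>X\<close>, and \<open>a\<close>
    can be put in front within \<open>X\<close>; otherwise \<open>b\<close> can be put in front
    within \<open>Y\<close>.\<close>
  proof (cases "Y m = Y b")
    case True
    then have "X a \<noteq> X m" using agree m B(1) ne by auto
    then have "a \<noteq> m" by auto
    then have lt: "\<forall>i\<in>B. a < i"
      using le m finB unfolding m_def by (metis Min_le le_antisym order_le_less)
    have "alternating X (insert a B)"
      using B(2) finB lt \<open>X a \<noteq> X m\<close> by (intro alternating_insert_less) (auto simp: m_def)
    then have "card (insert a B) \<le> alternation X"
      using a B(1) by (intro alternation_ge finX) auto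
    then show False using B(3) finB lt by (auto simp: card_insert_if split: if_splits)
  next
    case False
    have lt: "\<forall>i\<in>B. b < i" using le ba by fastforce
    have "alternating Y B" using B(1,2) agree alternating_cong[of B X Y] by (simp add: subset_iff)
    then have "alternating Y (insert b B)"
      using finB lt False by (intro alternating_insert_less) (auto simp: m_def)
    then have "card (insert b B) \<le> alternation Y"
      using b B(1) sub by (intro alternation_ge fin) auto
    then show False using B(3) eq finB lt by (auto simp: card_insert_if split: if_splits)
  qed
qed

section \<open>The bound for prime \<open>r\<close>\<close>

lemma support_rotv: "support (rotv p X) = support X"
  by (auto simp: support_def rotv_def)

lemma alternation_rotv: "alternation (rotv p X) = alternation X"
proof -
  have "alternating (rotv p X) = alternating X"
    by (simp add: alternating_def fun_eq_iff rotv_def rot_inj)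
  then show ?thesis by (simp add: alternation_def support_rotv)
qed

lemma rot_image: "p \<ge> 1 \<Longrightarrow> rot p ` {1..p} = {1..p}"
  by (rule endo_inj_surj) (auto simp: rot_def inj_on_def split: if_splits)

text \<open>The mean value modulo \<open>p\<close> of the elements of a set is an equivariant choice function.\<close>

lemma equivariant_choice:
  assumes "prime p"
  obtains s :: "nat set \<Rightarrow> nat" where
    "\<And>A. A \<subseteq> {1..p} \<Longrightarrow> A \<noteq> {} \<Longrightarrow> A \<noteq> {1..p} \<Longrightarrow> s A < p \<and> s (rot p ` A) = Suc (s A) mod p"
proof -
  have "p > 0" using assms by (simp add: prime_gt_0_nat)
  have unit: "\<exists>u. [card A * u = 1] (mod p)" if A: "A \<subseteq> {1..p}" "A \<noteq> {}" "A \<noteq> {1..p}" for A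
  proof -
    have "finite A" using A(1) finite_subset by blast
    then have "card A > 0" using A by (simp add: card_gt_0_iff)
    moreover have "card A < p" using psubset_card_mono[of "{1..p}" A] A by auto
    ultimately have "\<not> p dvd card A" using dvd_imp_le by fastforce
    then have "coprime (card A) p" using assms by (simp add: coprime_commute prime_imp_coprime)
    then show ?thesis using cong_solve_coprime_nat by auto
  qed
  define u where "u k = (SOME u. [k * u = 1] (mod p))" for k
  have u: "[card A * u (card A) = 1] (mod p)" if "A \<subseteq> {1..p}" "A \<noteq> {}" "A \<noteq> {1..p}" for A
    unfolding u_def by (rule someI_ex) (rule unit[OF that])
  \<comment> \<open>Rotation adds 1 to each element modulo p, hence \<open>card A\<close> to the
    sum, and hence 1 after multiplication by the inverse of \<open>card A\<close>.\<close>
  define s where "s A = (\<Sum>i\<in>A. i - 1) * u (card A) mod p" for A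
  show ?thesis
  proof (rule that[of s])
    fix A assume A: "A \<subseteq> {1..p}" "A \<noteq> {}" "A \<noteq> {1..p}"
    have card: "card (rot p ` A) = card A" by (simp add: card_image inj_on_def rot_inj)
    have "(\<Sum>i\<in>rot p ` A. i - 1) = (\<Sum>i\<in>A. rot p i - 1)"
      by (subst sum.reindex) (auto simp: inj_on_def rot_inj)
    also have "[\<dots> = (\<Sum>i\<in>A. (i - 1) + 1)] (mod p)"
    proof (rule cong_sum)
      fix i assume "i \<in> A"
      then have "1 \<le> i" "i \<le> p" using A(1) by auto
      then show "[rot p i - 1 = (i - 1) + 1] (mod p)" by (simp add: rot_mod cong_def)
    qed
    also have "(\<Sum>i\<in>A. (i - 1) + 1) = (\<Sum>i\<in>A. i - 1) + card A"
      by (subst sum.distrib) simp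
    finally have "[(\<Sum>i\<in>rot p ` A. i - 1) * u (card A) = ((\<Sum>i\<in>A. i - 1) + card A) * u (card A)] (mod p)"
      by (rule cong_mult) simp
    also have "((\<Sum>i\<in>A. i - 1) + card A) * u (card A) = (\<Sum>i\<in>A. i - 1) * u (card A) + card A * u (card A)"
      by (simp add: algebra_simps)
    also have "[\<dots> = (\<Sum>i\<in>A. i - 1) * u (card A) + 1] (mod p)"
      by (intro cong_add u A) simp
    finally show "s A < p \<and> s (rot p ` A) = Suc (s A) mod p"
      using \<open>p > 0\<close> by (simp add: s_def card cong_def mod_Suc_eq)
  qed
qed

text \<open>Equal ranks of neighbours would force equal labels, so ranks increase strictly and a
  chain is no longer than the range of ranks.\<close>

lemma sorted_wrt_less_rank:
  fixes rank :: "'a \<Rightarrow> nat"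
  assumes "sorted_wrt R c" "distinct_adj (map ind c)"
    and "\<And>x y. x \<in> set c \<Longrightarrow> y \<in> set c \<Longrightarrow> R x y \<Longrightarrow> rank x \<le> rank y"
    and "\<And>x y. x \<in> set c \<Longrightarrow> y \<in> set c \<Longrightarrow> R x y \<Longrightarrow> rank x = rank y \<Longrightarrow> ind x = ind y"
  shows "sorted_wrt (<) (map rank c)"
  using assms
proof (induction c rule: induct_list012)
  case (3 x y c)
  have "sorted_wrt (<) (map rank (y # c))"
    by (rule "3.IH"(2)) (use "3.prems" in auto)
  moreover have "rank x < rank y"
    using "3.prems"(1,2) "3.prems"(3,4)[of x y] by (fastforce simp: order_less_le)
  ultimately show ?case by auto
qed auto

text \<open>The labelling yields a chain of \<open>card S\<close> vectors whose ranks are distinct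
  numbers between 1 and \<open>\<alpha> + C * (p - 1)\<close>.\<close>

lemma alternation_theorem_prime:
  assumes "prime p" "finite S" "\<forall>e\<in>E. e \<noteq> {} \<and> col e < C" "kneser_proper p E col"
  shows "\<exists>Z. admissible p S E Z \<and> card S \<le> card (support Z) + C * (p - 1)"
proof (cases "S = {}")
  case True
  have "admissible p S E (\<lambda>_. 0)"
    using assms(3) by (auto simp: admissible_def support_def alternating_def)
  with True show ?thesis by (metis card.empty le0)
next
  case False
  have p2: "p \<ge> 2" using assms(1) by (rule prime_ge_2_nat)
  have "admissible p S E (\<lambda>_. 0)"
    using assms(3) by (auto simp: admissible_def support_def alternating_def)
  moreover have "\<forall>Z. admissible p S E Z \<longrightarrow> card (support Z) < Suc (card S)"
    using card_mono[OF \<open>finite S\<close>] by (auto simp: admissible_def less_Suc_eq_le)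
  ultimately obtain Z0 where Z0: "admissible p S E Z0"
    and max: "\<And>Z. admissible p S E Z \<Longrightarrow> card (support Z) \<le> card (support Z0)"
    using ex_has_greatest_nat[of "admissible p S E" _ "\<lambda>Z. card (support Z)"] by metis
  define \<alpha> where "\<alpha> = card (support Z0)"
  let ?Q = "nonzero_vectors p S"
  have sup: "support X \<subseteq> S" "finite (support X)" "support X \<noteq> {}" if "X \<in> ?Q" for X
  proof -
    show "support X \<subseteq> S" "support X \<noteq> {}"
      using that by (auto simp: nonzero_vectors_def support_def)
    then show "finite (support X)" using \<open>finite S\<close> finite_subset by blast
  qed
  define A where "A c X = {i\<in>{1..p}. \<exists>e\<in>E. col e = c \<and> e \<subseteq> {j. X j = i}}" for c and X :: "nat \<Rightarrow> nat"
  have A_sub: "A c X \<subseteq> {1..p}" for c X by (auto simp: A_def)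
  have A_fin: "finite (A c X)" for c X using A_sub finite_subset by blast
  \<comment> \<open>All p classes together would supply p disjoint edges of one colour. Hence the
    choice function applies to every nonempty \<open>A c X\<close>.\<close>
  have A_neq: "A c X \<noteq> {1..p}" for c X
  proof
    assume eq: "A c X = {1..p}"
    then have "\<forall>i\<in>{1..p}. \<exists>e. e \<in> E \<and> col e = c \<and> e \<subseteq> {j. X j = i}" unfolding A_def by blast
    then obtain e where e: "\<And>i. i \<in> {1..p} \<Longrightarrow> e i \<in> E \<and> col (e i) = c \<and> e i \<subseteq> {j. X j = i}"
      by metis
    have ne: "e i \<noteq> {}" if "i \<in> {1..p}" for i using e[OF that] assms(3) by auto
    have inj: "inj_on e {1..p}"
    proof (rule inj_onI)
      fix i j assume ij: "i \<in> {1..p}" "j \<in> {1..p}" "e i = e j"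
      obtain x where "x \<in> e i" using ne[OF ij(1)] by auto
      then show "i = j" using e[OF ij(1)] e[OF ij(2)] ij(3) by auto
    qed
    have "pairwise disjnt (e ` {1..p})"
      unfolding pairwise_image
    proof (rule pairwiseI, intro impI)
      fix i j assume ij: "i \<in> {1..p}" "j \<in> {1..p}" "i \<noteq> j"
      then show "disjnt (e i) (e j)" using e[OF ij(1)] e[OF ij(2)] by (auto simp: disjnt_def)
    qed
    moreover have "card (e ` {1..p}) = p" using card_image[OF inj] by simp
    moreover have "e ` {1..p} \<subseteq> E" "\<forall>x\<in>e ` {1..p}. col x = c" using e by auto
    ultimately show False using assms(4) unfolding kneser_proper_def by blast
  qed
  have A_card: "card (A c X) \<le> p - 1" for c X
    using psubset_card_mono[of "{1..p}" "A c X", OF _ psubsetI[OF A_sub A_neq]] by simp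
  have A_mono: "A c X \<subseteq> A c Y" if "extends X Y" for c X Y
  proof
    fix i assume "i \<in> A c X"
    then obtain e where e: "i \<in> {1..p}" "e \<in> E" "col e = c" "e \<subseteq> {j. X j = i}" by (auto simp: A_def)
    then have "e \<subseteq> {j. Y j = i}" using that by (auto simp: extends_def)
    with e show "i \<in> A c Y" by (auto simp: A_def)
  qed
  have A_rot: "A c (rotv p X) = rot p ` A c X" for c X
  proof -
    have "A c (rotv p X) = {i\<in>rot p ` {1..p}. \<exists>e\<in>E. col e = c \<and> e \<subseteq> {j. rot p (X j) = i}}"
      using p2 rot_image[of p] by (simp add: A_def rotv_def)
    also have "\<dots> = rot p ` {i\<in>{1..p}. \<exists>e\<in>E. col e = c \<and> e \<subseteq> {j. rot p (X j) = rot p i}}"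
      by blast
    also have "\<dots> = rot p ` A c X" by (simp only: A_def rot_inj)
    finally show ?thesis .
  qed
  \<comment> \<open>Restricted to an optimal alternating set, \<open>X\<close> has a support larger
    than the maximum \<open>\<alpha>\<close>; the only clause of admissibility that can then fail is
    the one on edges.\<close>
  have A_ex: "\<exists>c<C. A c X \<noteq> {}" if X: "X \<in> ?Q" "alternation X > \<alpha>" for X
  proof -
    obtain B where B: "B \<subseteq> support X" "alternating X B" "card B = alternation X"
      using alternation_witness sup[OF X(1)] by metis
    define Z where "Z i = (if i \<in> B then X i else 0)" for i
    have supZ: "support Z = B" using B(1) by (auto simp: support_def Z_def)
    have "\<not> admissible p S E Z" using max[of Z] X(2) supZ B(3) by (auto simp: \<alpha>_def)
    moreover have "alternating Z B" using B(2) alternating_cong[of B X Z] by (simp add: Z_def)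
    moreover have "\<forall>i. Z i \<le> p" "B \<subseteq> S"
      using X(1) B(1) sup[OF X(1)] by (auto simp: Z_def nonzero_vectors_def)
    ultimately obtain i e where ie: "i \<in> {1..p}" "e \<in> E" "e \<subseteq> {j. Z j = i}"
      unfolding admissible_def supZ by blast
    then have "e \<subseteq> {j. X j = i}" by (auto simp: Z_def split: if_splits)
    with ie have "i \<in> A (col e) X" by (auto simp: A_def)
    then show ?thesis using ie assms(3) by blast
  qed
  obtain s where s: "\<And>A. A \<subseteq> {1..p} \<Longrightarrow> A \<noteq> {} \<Longrightarrow> A \<noteq> {1..p} \<Longrightarrow>
      s A < p \<and> s (rot p ` A) = Suc (s A) mod p"
    using equivariant_choice[OF assms(1)] by blast
  \<comment> \<open>The first entry is shifted from 1..p to 0..p-1. The least available colour is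
    invariant under rotation, so equivariance of the second case comes from \<open>s\<close>
    alone.\<close>
  define ind where "ind X = (if alternation X \<le> \<alpha> then X (Min (support X)) - 1
    else s (A (LEAST c. A c X \<noteq> {}) X))" for X
  \<comment> \<open>Up to the threshold the alternation is counted, beyond it the pairs of a colour
    and a class containing an edge of that colour, of which there are at most p - 1 per
    colour.\<close>
  define rank where "rank X = (if alternation X \<le> \<alpha> then alternation X
    else \<alpha> + (\<Sum>c<C. card (A c X)))" for X
  have ind: "ind X < p \<and> ind (rotv p X) = Suc (ind X) mod p" if X: "X \<in> ?Q" for X
  proof (cases "alternation X \<le> \<alpha>")
    case True
    have "Min (support X) \<in> support X" using sup[OF X] by simp
    then have "1 \<le> X (Min (support X))" "X (Min (support X)) \<le> p"
      using X by (auto simp: support_def nonzero_vectors_def)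
    then show ?thesis using True
      by (simp add: ind_def alternation_rotv support_rotv) (simp add: rotv_def rot_mod)
  next
    case False
    then obtain c where "A c X \<noteq> {}" using A_ex[OF X] by auto
    then have "A (LEAST c. A c X \<noteq> {}) X \<noteq> {}" by (rule LeastI)
    moreover have "ind (rotv p X) = s (rot p ` A (LEAST c. A c X \<noteq> {}) X)"
      using False by (simp add: ind_def alternation_rotv A_rot)
    ultimately show ?thesis using s[OF A_sub _ A_neq] False by (simp add: ind_def)
  qed
  have rank: "rank X \<le> rank Y \<and> (rank X = rank Y \<longrightarrow> ind X = ind Y)"
    if X: "X \<in> ?Q" and Y: "Y \<in> ?Q" and ext: "extends X Y" for X Y
  proof -
    have mono: "alternation X \<le> alternation Y"
      using ext sup[OF Y] by (intro alternation_mono)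
    consider "alternation Y \<le> \<alpha>" | "alternation X \<le> \<alpha>" "alternation Y > \<alpha>" | "alternation X > \<alpha>"
      by linarith
    then show ?thesis
    proof cases
      case 1
      then show ?thesis
        using mono alternation_eq_first[OF ext] sup[OF Y] X
        by (auto simp: rank_def ind_def nonzero_vectors_def)
    next
      \<comment> \<open>Crossing the threshold makes some \<open>A c Y\<close> nonempty, so the rank
        increases strictly and labels need not be compared.\<close>
      case 2
      obtain c where c: "c < C" "A c Y \<noteq> {}" using A_ex[OF Y 2(2)] by auto
      then have "0 < card (A c Y)" using A_fin by (simp add: card_gt_0_iff)
      also have "\<dots> \<le> (\<Sum>c<C. card (A c Y))" using c by (intro member_le_sum) auto
      finally show ?thesis using 2 by (simp add: rank_def)
    next
      case 3
      have le: "card (A c X) \<le> card (A c Y)" for c using A_mono[OF ext] A_fin by (intro card_mono)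
      have outside: "A c Z = {}" if "c \<ge> C" for c Z using that assms(3) by (auto simp: A_def)
      have "ind X = ind Y" if "(\<Sum>c<C. card (A c X)) = (\<Sum>c<C. card (A c Y))"
      proof -
        have eq: "A c X = A c Y" for c
        proof (cases "c < C")
          case True
          then have "card (A c X) = card (A c Y)"
            using sum_mono_inv[OF that, of c] le by simp
          then show ?thesis using A_mono[OF ext] A_fin card_subset_eq by metis
        next
          case False
          then show ?thesis using outside[of c X] outside[of c Y] by simp
        qed
        show ?thesis using 3 mono by (simp add: ind_def eq)
      qed
      moreover have "(\<Sum>c<C. card (A c X)) \<le> (\<Sum>c<C. card (A c Y))" using le by (intro sum_mono)
      ultimately show ?thesis using 3 mono by (simp add: rank_def)
    qed
  qed
  obtain c where c: "length c = card S" "set c \<subseteq> ?Q" "sorted_wrt extends c" "distinct_adj (map ind c)"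
    using equivariant_labelling_chain[OF p2 \<open>finite S\<close> False, of ind] ind by blast
  have "sorted_wrt (<) (map rank c)"
    using c rank by (intro sorted_wrt_less_rank[where R = extends and ind = ind]) blast+
  then have "distinct (map rank c)" using strict_sorted_iff by blast
  then have "card S = card (rank ` set c)" using c(1) distinct_card[of "map rank c"] by simp
  also have "\<dots> \<le> card {1..\<alpha> + C * (p - 1)}"
  proof (intro card_mono image_subsetI)
    fix X assume "X \<in> set c"
    then have X: "X \<in> ?Q" using c by blast
    have "(\<Sum>c<C. card (A c X)) \<le> C * (p - 1)"
      using sum_bounded_above[of "{..<C}" "\<lambda>c. card (A c X)" "p - 1"] A_card by simp
    moreover have "(\<Sum>c<C. card (A c X)) \<ge> 1" if large: "alternation X > \<alpha>"
    proof -
      obtain c where c: "c < C" "A c X \<noteq> {}" using A_ex[OF X large] by auto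
      then have "0 < card (A c X)" using A_fin by (simp add: card_gt_0_iff)
      also have "\<dots> \<le> (\<Sum>c<C. card (A c X))" using c by (intro member_le_sum) auto
      finally show ?thesis by simp
    qed
    moreover have "alternation X \<ge> 1"
      using X sup[OF X] by (intro alternation_pos) (auto simp: nonzero_vectors_def)
    ultimately show "rank X \<in> {1..\<alpha> + C * (p - 1)}" by (auto simp: rank_def)
  qed simp
  finally have "card S \<le> card (support Z0) + C * (p - 1)" by (simp add: \<alpha>_def)
  with Z0 show ?thesis by blast
qed


section \<open>Multiplicativity in \<open>r\<close>\<close>

text \<open>All ground sets, families and colourings are quantified, since the product step applies
  the bound to subsets of \<open>S\<close> and to a new family derived from
  \<open>E\<close>.\<close>

definition alternation_bound :: "nat \<Rightarrow> bool" where
  "alternation_bound r \<longleftrightarrow> (\<forall>S E col C. finite S \<longrightarrow> (\<forall>e\<in>E. e \<noteq> {} \<and> col e < C) \<longrightarrow>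
     kneser_proper r E col \<longrightarrow>
     (\<exists>Z. admissible r S E Z \<and> card S \<le> card (support Z) + C * (r - 1)))"

lemma mult_add_inj_nat:
  fixes b k k' u u' :: nat
  assumes "u * b + k = u' * b + k'" "1 \<le> k" "k \<le> b" "1 \<le> k'" "k' \<le> b"
  shows "u = u'" "k = k'"
proof -
  show "u = u'"
    using assms mult_le_mono1[of "Suc u" u' b] mult_le_mono1[of "Suc u'" u b]
    by (cases u u' rule: linorder_cases) auto
  with assms(1) show "k = k'" by simp
qed

text \<open>Following Alon, Frankl and Lovasz: the sets \<open>A\<close> violating the bound for \<open>b\<close> contain \<open>b\<close>
  disjoint edges of one colour, and the bound for \<open>a\<close> applies to them coloured in this way.\<close>

lemma alternation_bound_mult:
  assumes "alternation_bound a" "alternation_bound b" "a \<ge> 1" "b \<ge> 1"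
  shows "alternation_bound (a * b)"
  unfolding alternation_bound_def
proof (intro allI impI)
  fix S :: "nat set" and E :: "nat set set" and col C
  assume finS: "finite S" and E: "\<forall>e\<in>E. e \<noteq> {} \<and> col e < C"
    and proper: "kneser_proper (a * b) E col"
  define good where "good A \<longleftrightarrow> (\<exists>Z. admissible b A {e\<in>E. e \<subseteq> A} Z \<and>
     card A \<le> card (support Z) + C * (b - 1))" for A
  define T where "T = {A. A \<subseteq> S \<and> \<not> good A}"
  have "\<exists>F c. F \<subseteq> {e\<in>E. e \<subseteq> A} \<and> card F = b \<and> pairwise disjnt F \<and> (\<forall>e\<in>F. col e = c)"
    if "A \<in> T" for A
  proof -
    have "finite A" "\<not> good A" using that finS finite_subset by (auto simp: T_def)
    moreover have "\<forall>e\<in>{e\<in>E. e \<subseteq> A}. e \<noteq> {} \<and> col e < C" using E by auto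
    ultimately have "\<not> kneser_proper b {e\<in>E. e \<subseteq> A} col"
      using assms(2) unfolding alternation_bound_def good_def by blast
    then show ?thesis unfolding kneser_proper_def by blast
  qed
  then obtain F c where F: "\<And>A. A \<in> T \<Longrightarrow> F A \<subseteq> {e\<in>E. e \<subseteq> A} \<and> card (F A) = b \<and>
      pairwise disjnt (F A) \<and> (\<forall>e\<in>F A. col e = c A)"
    by metis
  have F_fin: "finite (F A)" "F A \<noteq> {}" if "A \<in> T" for A
  proof -
    have "0 < card (F A)" using F[OF that] assms(4) by simp
    then show "finite (F A)" "F A \<noteq> {}" by (simp_all add: card_gt_0_iff)
  qed
  have "\<forall>A\<in>T. A \<noteq> {} \<and> c A < C"
  proof
    fix A assume A: "A \<in> T"
    then obtain e where "e \<in> F A" using F_fin by auto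
    with F[OF A] have "e \<in> E" "e \<subseteq> A" "col e = c A" by auto
    with E show "A \<noteq> {} \<and> c A < C" by auto
  qed
  \<comment> \<open>Otherwise \<open>a\<close> disjoint members of \<open>T\<close> of one colour
    would supply \<open>a * b\<close> disjoint edges of \<open>E\<close> of that colour.\<close>
  moreover have "kneser_proper a T c"
    unfolding kneser_proper_def
  proof
    assume "\<exists>G\<subseteq>T. card G = a \<and> pairwise disjnt G \<and> (\<exists>x. \<forall>A\<in>G. c A = x)"
    then obtain G x where G: "G \<subseteq> T" "card G = a" "pairwise disjnt G" "\<forall>A\<in>G. c A = x" by auto
    have finG: "finite G" using G(2) assms(3) by (intro card_ge_0_finite) simp
    have sep: "disjnt e e'" if "A \<in> G" "A' \<in> G" "A \<noteq> A'" "e \<in> F A" "e' \<in> F A'" for A A' e e'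
    proof -
      have "e \<subseteq> A" "e' \<subseteq> A'" using that F G(1) by blast+
      moreover have "disjnt A A'" using G(3) that by (auto simp: pairwise_def)
      ultimately show ?thesis by (auto simp: disjnt_def)
    qed
    have "card (\<Union>A\<in>G. F A) = (\<Sum>A\<in>G. card (F A))"
    proof (rule card_UN_disjoint[OF finG])
      show "\<forall>A\<in>G. finite (F A)" using F_fin G(1) by blast
      show "\<forall>A\<in>G. \<forall>A'\<in>G. A \<noteq> A' \<longrightarrow> F A \<inter> F A' = {}"
      proof (intro ballI impI equals0I)
        fix A A' e assume *: "A \<in> G" "A' \<in> G" "A \<noteq> A'" "e \<in> F A \<inter> F A'"
        then have "disjnt e e" using sep by blast
        moreover have "e \<noteq> {}" using * F G(1) E by blast
        ultimately show False by (simp add: disjnt_def)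
      qed
    qed
    also have "\<dots> = (\<Sum>A\<in>G. b)" using F G(1) by (intro sum.cong) auto
    finally have "card (\<Union>A\<in>G. F A) = a * b" using G(2) by simp
    moreover have "pairwise disjnt (\<Union>A\<in>G. F A)"
    proof (rule pairwiseI)
      fix e e' assume "e \<in> (\<Union>A\<in>G. F A)" "e' \<in> (\<Union>A\<in>G. F A)" "e \<noteq> e'"
      then obtain A A' where *: "A \<in> G" "A' \<in> G" "e \<in> F A" "e' \<in> F A'" by auto
      show "disjnt e e'"
      proof (cases "A = A'")
        case True
        have "pairwise disjnt (F A)" using F * G(1) by blast
        then show ?thesis using * True \<open>e \<noteq> e'\<close> by (auto simp: pairwise_def)
      qed (use sep * in blast)
    qed
    moreover have "(\<Union>A\<in>G. F A) \<subseteq> E" using F G(1) by blast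
    moreover have "\<forall>e\<in>(\<Union>A\<in>G. F A). col e = x" using F G(1,4) by (metis UN_E subsetD)
    ultimately show False using proper unfolding kneser_proper_def by blast
  qed
  ultimately obtain Z1 where Z1: "admissible a S T Z1" "card S \<le> card (support Z1) + C * (a - 1)"
    using assms(1) finS unfolding alternation_bound_def by blast
  define X where "X i = {j. Z1 j = i}" for i
  have X_sub: "X i \<subseteq> S" if "i \<in> {1..a}" for i
    using that Z1(1) by (auto simp: X_def admissible_def support_def)
  have "good (X i)" if "i \<in> {1..a}" for i
  proof -
    have "X i \<notin> T" using Z1(1) that unfolding admissible_def X_def by blast
    with X_sub[OF that] show ?thesis by (simp add: T_def)
  qed
  then obtain W where W: "\<And>i. i \<in> {1..a} \<Longrightarrow> admissible b (X i) {e\<in>E. e \<subseteq> X i} (W i) \<and>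
      card (X i) \<le> card (support (W i)) + C * (b - 1)"
    unfolding good_def by metis
  have W_le: "W i j \<le> b" if "i \<in> {1..a}" for i j using W[OF that] by (auto simp: admissible_def)
  have W_sup: "support (W i) \<subseteq> X i" if "i \<in> {1..a}" for i using W[OF that] by (auto simp: admissible_def)
  have Z1_in: "Z1 j \<in> {1..a}" if "Z1 j \<noteq> 0" for j
    using that Z1(1) by (auto simp: admissible_def Suc_le_eq)
  \<comment> \<open>The inner class \<open>k\<close> of the outer class \<open>i\<close> receives
    the number \<open>(i - 1) * b + k\<close> between 1 and \<open>a * b\<close>; positions where
    either vector is zero are dropped.\<close>
  define Z where "Z j = (if Z1 j = 0 \<or> W (Z1 j) j = 0 then 0 else (Z1 j - 1) * b + W (Z1 j) j)" for j
  have Z_supp: "support Z = (\<Union>i\<in>{1..a}. support (W i))"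
  proof (intro set_eqI iffI)
    fix j assume "j \<in> support Z"
    then have "Z1 j \<noteq> 0" "W (Z1 j) j \<noteq> 0" by (auto simp: support_def Z_def split: if_splits)
    then show "j \<in> (\<Union>i\<in>{1..a}. support (W i))" using Z1_in by (auto simp: support_def)
  next
    fix j assume "j \<in> (\<Union>i\<in>{1..a}. support (W i))"
    then obtain i where i: "i \<in> {1..a}" "j \<in> support (W i)" by auto
    then have "Z1 j = i" using W_sup by (auto simp: X_def)
    then show "j \<in> support Z" using i by (auto simp: support_def Z_def)
  qed
  have Z_inj: "Z1 i = Z1 j \<and> W (Z1 i) i = W (Z1 i) j \<and> Z1 i \<in> {1..a} \<and> W (Z1 i) i \<noteq> 0"
    if "Z i = Z j" "Z i \<noteq> 0" for i j
  proof -
    have nz: "Z1 i \<noteq> 0" "W (Z1 i) i \<noteq> 0" "Z1 j \<noteq> 0" "W (Z1 j) j \<noteq> 0"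
      using that by (auto simp: Z_def split: if_splits)
    then have "(Z1 i - 1) * b + W (Z1 i) i = (Z1 j - 1) * b + W (Z1 j) j"
      using that(1) by (simp add: Z_def)
    from mult_add_inj_nat[OF this] nz W_le[OF Z1_in] have "Z1 i - 1 = Z1 j - 1" "W (Z1 i) i = W (Z1 j) j"
      by (auto simp: Suc_le_eq)
    then show ?thesis using nz Z1_in by (metis One_nat_def Suc_pred not_gr_zero)
  qed
  have "admissible (a * b) S E Z"
    unfolding admissible_def
  proof (intro conjI allI ballI notI)
    fix j
    show "Z j \<le> a * b"
    proof (cases "Z1 j = 0 \<or> W (Z1 j) j = 0")
      case False
      then have "Z1 j \<in> {1..a}" using Z1_in by blast
      then have "(Z1 j - 1) * b + W (Z1 j) j \<le> (Z1 j - 1) * b + b" using W_le by simp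
      also have "\<dots> = Z1 j * b" using \<open>Z1 j \<in> {1..a}\<close> by (cases "Z1 j") auto
      also have "\<dots> \<le> a * b" using \<open>Z1 j \<in> {1..a}\<close> by simp
      finally show ?thesis using False by (simp add: Z_def)
    qed (auto simp: Z_def)
  next
    show "support Z \<subseteq> S" using Z_supp W_sup X_sub by blast
  next
    show "alternating Z (support Z)"
      unfolding alternating_def
    proof (intro ballI impI notI)
      fix i j assume ij: "i \<in> support Z" "j \<in> support Z" "i < j" "{i<..<j} \<inter> support Z = {}" "Z i = Z j"
      \<comment> \<open>Equal entries of \<open>Z\<close> lie in one outer class \<open>u\<close>
        and have equal entries in \<open>W u\<close>. As \<open>support (W u)\<close> is part of
        \<open>support Z\<close>, they would also be neighbours there.\<close>
      define u where "u = Z1 i"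
      have u: "u \<in> {1..a}" "W u i = W u j" "W u i \<noteq> 0"
        using Z_inj[OF ij(5)] ij(1) by (auto simp: support_def u_def)
      have "alternating (W u) (support (W u))" using W[OF u(1)] by (simp add: admissible_def)
      moreover have "{i<..<j} \<inter> support (W u) = {}" using ij(4) Z_supp u(1) by blast
      moreover have "i \<in> support (W u)" "j \<in> support (W u)" using u by (auto simp: support_def)
      ultimately show False using u(2) ij(3) unfolding alternating_def by blast
    qed
  next
    fix k e assume k: "k \<in> {1..a * b}" and e: "e \<in> E" "e \<subseteq> {j. Z j = k}"
    obtain i where i: "i \<in> e" using E e(1) by auto
    then have "Z i = k" "Z i \<noteq> 0" using e k by auto
    define u where "u = Z1 i"
    have *: "Z1 j = u \<and> W u j = W u i" if "j \<in> e" for j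
    proof -
      have "Z i = Z j" using that e(2) \<open>Z i = k\<close> by auto
      from Z_inj[OF this \<open>Z i \<noteq> 0\<close>] show ?thesis by (auto simp: u_def)
    qed
    have u: "u \<in> {1..a}" "W u i \<noteq> 0" using Z_inj[of i i] \<open>Z i \<noteq> 0\<close> by (auto simp: u_def)
    have "W u i \<in> {1..b}" using u W_le by (auto simp: Suc_le_eq)
    moreover have "e \<in> {e\<in>E. e \<subseteq> X u}" "e \<subseteq> {j. W u j = W u i}" using * e(1) by (auto simp: X_def)
    ultimately show False using W[OF u(1)] unfolding admissible_def by blast
  qed
  \<comment> \<open>The outer vector loses at most \<open>C * (a - 1)\<close> positions and each of
    the \<open>a\<close> inner ones at most \<open>C * (b - 1)\<close>, which adds up
    exactly.\<close>
  moreover have "card S \<le> card (support Z) + C * (a * b - 1)"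
  proof -
    have X_fin: "finite (X i)" if "i \<in> {1..a}" for i using X_sub[OF that] finS finite_subset by blast
    have "support Z1 = (\<Union>i\<in>{1..a}. X i)"
      using Z1_in by (auto simp: support_def X_def)
    also have "card \<dots> = (\<Sum>i\<in>{1..a}. card (X i))"
      using X_fin by (intro card_UN_disjoint) (auto simp: X_def)
    also have "\<dots> \<le> (\<Sum>i\<in>{1..a}. card (support (W i)) + C * (b - 1))"
      using W by (intro sum_mono) blast
    also have "\<dots> = (\<Sum>i\<in>{1..a}. card (support (W i))) + a * (C * (b - 1))"
      by (simp only: sum.distrib) simp
    also have "(\<Sum>i\<in>{1..a}. card (support (W i))) = card (support Z)"
      unfolding Z_supp
    proof (rule card_UN_disjoint[symmetric])
      show "\<forall>i\<in>{1..a}. finite (support (W i))" using W_sup X_fin finite_subset by blast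
      show "\<forall>i\<in>{1..a}. \<forall>j\<in>{1..a}. i \<noteq> j \<longrightarrow> support (W i) \<inter> support (W j) = {}"
      proof (intro ballI impI)
        fix i j assume "i \<in> {1..a}" "j \<in> {1..a}" "i \<noteq> j"
        then show "support (W i) \<inter> support (W j) = {}" using W_sup[of i] W_sup[of j] by (auto simp: X_def)
      qed
    qed simp
    finally have "card S \<le> card (support Z) + a * (C * (b - 1)) + C * (a - 1)"
      using Z1(2) by simp
    moreover have "a * (C * (b - 1)) + C * (a - 1) = C * (a * b - 1)"
      using assms(3,4) by (cases a; cases b) (auto simp: algebra_simps)
    ultimately show ?thesis by simp
  qed
  ultimately show "\<exists>Z. admissible (a * b) S E Z \<and> card S \<le> card (support Z) + C * (a * b - 1)"
    by blast
qed

text \<open>A composite number has two factors, both at least 2 and smaller than itself, so strong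
  induction leaves only the primes.\<close>

theorem alternation_theorem:
  assumes "r \<ge> 2"
  shows "alternation_bound r"
  using assms
proof (induction r rule: less_induct)
  case (less r)
  show ?case
  proof (cases "prime r")
    case True
    then show ?thesis using alternation_theorem_prime unfolding alternation_bound_def by blast
  next
    case False
    then obtain a where a: "a dvd r" "a \<noteq> 1" "a \<noteq> r" using less.prems by (auto simp: prime_nat_iff)
    then obtain b where b: "r = a * b" by auto
    have "a \<noteq> 0" "b \<noteq> 0" using b less.prems by (auto intro: ccontr)
    moreover have "b \<noteq> 1" using a b by auto
    ultimately have "a \<ge> 2" "b \<ge> 2" using a by auto
    moreover from this have "a < r" "b < r" using b mult_le_mono2[of 2 b a] mult_le_mono1[of 2 a b] by auto
    ultimately have "alternation_bound a" "alternation_bound b" using less.IH by auto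
    then show ?thesis
      unfolding b using \<open>a \<ge> 2\<close> \<open>b \<ge> 2\<close> by (intro alternation_bound_mult) auto
  qed
qed

section \<open>Random Kneser hypergraphs\<close>

lemma alt_bounds:
  shows alt_ge: "subseq Y X \<Longrightarrow> 0 \<notin> set Y \<Longrightarrow> distinct_adj Y \<Longrightarrow> length Y \<le> alt X"
    and alt_le_length: "alt X \<le> length X"
proof -
  let ?L = "{length Y |Y. subseq Y X \<and> 0 \<notin> set Y \<and> distinct_adj Y}"
  have "?L \<subseteq> {..length X}" by (auto dest: list_emb_length)
  then have fin: "finite ?L" using finite_subset by blast
  show "length Y \<le> alt X" if "subseq Y X" "0 \<notin> set Y" "distinct_adj Y"
    unfolding alt_def using that fin by (intro Max_ge) auto
  have "length ([] :: nat list) \<in> ?L" by force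
  then have "alt X \<in> ?L" unfolding alt_def using fin by (intro Max_in) auto
  with \<open>?L \<subseteq> _\<close> show "alt X \<le> length X" by auto
qed

definition alt_feasible :: "nat \<Rightarrow> 'a hypergraph \<Rightarrow> (nat \<Rightarrow> 'a) \<Rightarrow> int \<Rightarrow> nat list set" where
  "alt_feasible r H \<sigma> q = {X. length X = card (verts H) \<and> set X \<subseteq> {0..r} \<and>
       (\<forall>i\<in>{1..r}. int (card (edges (induced H (\<sigma> ` positions X i)))) \<le> q - 1)}"

lemma alt_perm_eq: "alt_perm r H \<sigma> q = Max (alt ` alt_feasible r H \<sigma> q)"
  unfolding alt_perm_def alt_feasible_def by (rule arg_cong[of _ _ Max]) blast

lemma finite_alt_feasible: "finite (alt_feasible r H \<sigma> q)"
  by (rule finite_subset[OF _ finite_lists_length_eq[of "{0..r}" "card (verts H)"]])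
     (auto simp: alt_feasible_def)

lemma alt_perm_ge: "X \<in> alt_feasible r H \<sigma> q \<Longrightarrow> alt X \<le> alt_perm r H \<sigma> q"
  unfolding alt_perm_eq by (intro Max_ge finite_imageI finite_alt_feasible imageI)

text \<open>For \<open>q \<ge> 1\<close> the zero vector is feasible, because no edge lies in the
  empty set; thus the maximum is over a nonempty set and is attained.\<close>

lemma alt_perm_le:
  assumes "hypergraph H" "q \<ge> 1"
  shows "alt_perm r H \<sigma> q \<le> card (verts H)"
proof -
  let ?O = "replicate (card (verts H)) (0::nat)"
  have "edges (induced H (\<sigma> ` positions ?O i)) = {}" if "i \<in> {1..r}" for i
  proof -
    have "positions ?O i = {}" using that by (auto simp: positions_def)
    then show ?thesis using assms(1) by (auto simp: induced_def hypergraph_def)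
  qed
  then have "?O \<in> alt_feasible r H \<sigma> q"
    using assms(2) by (auto simp: alt_feasible_def)
  then have "alt_perm r H \<sigma> q \<in> alt ` alt_feasible r H \<sigma> q"
    unfolding alt_perm_eq by (intro Max_in finite_imageI finite_alt_feasible) auto
  then show ?thesis using alt_le_length by (auto simp: alt_feasible_def) (metis alt_le_length)
qed

lemma alt_num_attained:
  assumes "hypergraph H" "q \<ge> 1"
  obtains \<sigma> where "bij_betw \<sigma> {..<card (verts H)} (verts H)" "alt_num r H q = alt_perm r H \<sigma> q"
proof -
  let ?P = "{alt_perm r H \<sigma> q |\<sigma>. bij_betw \<sigma> {..<card (verts H)} (verts H)}"
  have "?P \<subseteq> {..card (verts H)}" using alt_perm_le[OF assms] by auto
  then have fin: "finite ?P" using finite_subset by blast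
  have "\<exists>\<sigma>. bij_betw \<sigma> {..<card (verts H)} (verts H)"
    using assms(1) by (auto simp: hypergraph_def lessThan_atLeast0 intro: ex_bij_betw_nat_finite)
  then have "alt_num r H q \<in> ?P" unfolding alt_num_def using fin by (intro Min_in) auto
  then show ?thesis using that by auto
qed

lemma distinct_adj_map_alternating:
  assumes "sorted_wrt (<) L" "alternating Z (set L)"
  shows "distinct_adj (map Z L)"
  using assms
proof (induction L rule: induct_list012)
  case (3 x y L)
  have "{x<..<y} \<inter> set (x # y # L) = {}" using "3.prems"(1) by auto
  then have "Z x \<noteq> Z y" using "3.prems" by (auto simp: alternating_def)
  moreover have "alternating Z (set (y # L))"
    unfolding alternating_def
  proof (intro ballI impI)
    fix i j assume ij: "i \<in> set (y # L)" "j \<in> set (y # L)" "i < j" "{i<..<j} \<inter> set (y # L) = {}"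
    have "x < i" using ij(1) "3.prems"(1) by auto
    then have "{i<..<j} \<inter> set (x # y # L) = {}" using ij(4) by auto
    then show "Z i \<noteq> Z j" using "3.prems"(2) ij unfolding alternating_def by auto
  qed
  then have "distinct_adj (map Z (y # L))" using "3.IH"(2) "3.prems"(1) by simp
  ultimately show ?case by simp
qed auto

text \<open>The nonzero entries of \<open>Z\<close>, read in order, are themselves an alternating
  subsequence.\<close>

lemma card_support_le_alt:
  assumes "support Z \<subseteq> {..<n}" "alternating Z (support Z)"
  shows "card (support Z) \<le> alt (map Z [0..<n])"
proof -
  define L where "L = filter (\<lambda>j. Z j \<noteq> 0) [0..<n]"
  have setL: "set L = support Z" using assms(1) by (auto simp: L_def support_def)
  have "sorted_wrt (<) L" unfolding L_def by (intro sorted_wrt_filter) simp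
  then have dist: "distinct_adj (map Z L)" using assms(2) setL by (intro distinct_adj_map_alternating) simp_all
  have "card (support Z) = length (map Z L)"
    using distinct_card[of L] setL by (simp add: L_def)
  also have "\<dots> \<le> alt (map Z [0..<n])"
    by (rule alt_ge) (use dist in \<open>auto simp: L_def intro: subseq_map\<close>)
  finally show ?thesis .
qed

lemma pigeonhole_colour:
  fixes col :: "'a \<Rightarrow> nat"
  assumes "col ` F \<subseteq> {..<k}" "k * (t - 1) < card F"
  obtains j where "j < k" "card {e\<in>F. col e = j} \<ge> t"
proof (rule ccontr)
  assume none: "\<not> thesis"
  have fin: "finite F" using assms(2) card_gt_0_iff[of F] by auto
  have "card F = card (\<Union>j\<in>{..<k}. {e\<in>F. col e = j})"
    using assms(1) by (intro arg_cong[of _ _ card]) auto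
  also have "\<dots> = (\<Sum>j<k. card {e\<in>F. col e = j})"
    using fin by (intro card_UN_disjoint) auto
  also have "\<dots> \<le> (\<Sum>j<k. t - 1)"
  proof (rule sum_mono)
    fix j assume "j \<in> {..<k}"
    then have "\<not> t \<le> card {e\<in>F. col e = j}" using none that by auto
    then show "card {e\<in>F. col e = j} \<le> t - 1" by simp
  qed
  finally show False using assms(2) by simp
qed

text \<open>Sets spanning at least \<open>q\<close> edges are pulled back to positions along an
  optimal ordering, and each gets a colour used at least \<open>t\<close> times on its family. Were
  this colouring proper, the deterministic bound would contradict the last hypothesis.\<close>

lemma disjoint_monochromatic_families:
  assumes H: "hypergraph H" and r: "r \<ge> 2" and q: "q \<ge> 1"
    and Fs: "\<And>A. A \<subseteq> verts H \<Longrightarrow> card {e\<in>edges H. e \<subseteq> A} \<ge> q \<Longrightarrow>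
                Fs A \<subseteq> {e\<in>edges H. e \<subseteq> A} \<and> card (Fs A) = q"
    and col: "col ` edges H \<subseteq> {..<k}" and k1: "k * (t - 1) < q"
    and k2: "k * (r - 1) + alt_num r H (int q) < card (verts H)"
  shows "\<exists>B a. (\<forall>i\<in>{1..r}. B i \<subseteq> verts H \<and> card {e\<in>edges H. e \<subseteq> B i} \<ge> q \<and>
            card {e\<in>Fs (B i). col e = a} \<ge> t) \<and> disjoint_family_on B {1..r}"
proof -
  define n where "n = card (verts H)"
  obtain \<sigma> where \<sigma>: "bij_betw \<sigma> {..<n} (verts H)" "alt_num r H (int q) = alt_perm r H \<sigma> (int q)"
    using alt_num_attained[OF H, of "int q" r] q n_def by auto
  define E where "E = {B. B \<subseteq> {..<n} \<and> card {e\<in>edges H. e \<subseteq> \<sigma> ` B} \<ge> q}"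
  have sub: "\<sigma> ` B \<subseteq> verts H" if "B \<subseteq> {..<n}" for B
    using that \<sigma>(1) by (auto simp: bij_betw_def)
  have "\<exists>j<k. card {e\<in>Fs (\<sigma> ` B). col e = j} \<ge> t" if "B \<in> E" for B
  proof -
    have "Fs (\<sigma> ` B) \<subseteq> {e\<in>edges H. e \<subseteq> \<sigma> ` B}" "card (Fs (\<sigma> ` B)) = q"
      using Fs[of "\<sigma> ` B"] sub that by (auto simp: E_def)
    then have "col ` Fs (\<sigma> ` B) \<subseteq> {..<k}" "k * (t - 1) < card (Fs (\<sigma> ` B))"
      using col k1 by auto
    then show ?thesis by (rule pigeonhole_colour) auto
  qed
  then obtain c where c: "\<And>B. B \<in> E \<Longrightarrow> c B < k \<and> card {e\<in>Fs (\<sigma> ` B). col e = c B} \<ge> t"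
    by (atomize_elim, intro choice) auto
  have "B \<noteq> {}" if "B \<in> E" for B
  proof
    assume "B = {}"
    then have "{e\<in>edges H. e \<subseteq> \<sigma> ` B} = {}" using H by (auto simp: hypergraph_def)
    then have "card {e\<in>edges H. e \<subseteq> \<sigma> ` B} = 0" by (simp only: card.empty)
    then show False using that q by (simp add: E_def del: card_0_eq)
  qed
  then have E: "\<forall>B\<in>E. B \<noteq> {} \<and> c B < k" using c by blast
  have "\<not> kneser_proper r E c"
  proof
    assume "kneser_proper r E c"
    then obtain Z where Z: "admissible r {..<n} E Z" "card {..<n} \<le> card (support Z) + k * (r - 1)"
      using alternation_theorem[OF r] E unfolding alternation_bound_def by (meson finite_lessThan)
    \<comment> \<open>A class containing no member of \<open>E\<close> is not in \<open>E\<close>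
      itself, so it spans fewer than \<open>q\<close> edges, as feasibility demands.\<close>
    have "map Z [0..<n] \<in> alt_feasible r H \<sigma> (int q)"
      unfolding alt_feasible_def
    proof (intro CollectI conjI ballI)
      show "set (map Z [0..<n]) \<subseteq> {0..r}" using Z(1) by (auto simp: admissible_def)
      fix i assume i: "i \<in> {1..r}"
      have pos: "positions (map Z [0..<n]) i \<subseteq> {j. Z j = i}" "positions (map Z [0..<n]) i \<subseteq> {..<n}"
        by (auto simp: positions_def)
      then have "positions (map Z [0..<n]) i \<notin> E" using Z(1) i unfolding admissible_def by blast
      then have "card {e\<in>edges H. e \<subseteq> \<sigma> ` positions (map Z [0..<n]) i} < q"
        using pos(2) by (simp add: E_def)
      then show "int (card (edges (induced H (\<sigma> ` positions (map Z [0..<n]) i)))) \<le> int q - 1"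
        by (simp add: induced_def)
    qed (simp add: n_def)
    then have "alt (map Z [0..<n]) \<le> alt_num r H (int q)" using alt_perm_ge \<sigma>(2) by metis
    moreover have "card (support Z) \<le> alt (map Z [0..<n])"
      using Z(1) by (intro card_support_le_alt) (auto simp: admissible_def)
    ultimately show False using Z(2) k2 by (simp add: n_def)
  qed
  then obtain G a where G: "G \<subseteq> E" "card G = r" "pairwise disjnt G" "\<forall>B\<in>G. c B = a"
    unfolding kneser_proper_def by blast
  have "finite G" using G(2) r by (intro card_ge_0_finite) simp
  then obtain g where g: "bij_betw g {1..r} G" using ex_bij_betw_nat_finite_1[of G] G(2) by auto
  have gG: "g i \<in> G" if "i \<in> {1..r}" for i using g that by (auto simp: bij_betw_def)
  show ?thesis
  proof (intro exI[of _ "\<lambda>i. \<sigma> ` g i"] exI[of _ a] conjI ballI)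
    fix i assume i: "i \<in> {1..r}"
    then have "g i \<in> E" "c (g i) = a" using gG G by auto
    then show "\<sigma> ` g i \<subseteq> verts H" "card {e\<in>edges H. e \<subseteq> \<sigma> ` g i} \<ge> q"
      "card {e\<in>Fs (\<sigma> ` g i). col e = a} \<ge> t"
      using sub c[of "g i"] by (auto simp: E_def)
  next
    show "disjoint_family_on (\<lambda>i. \<sigma> ` g i) {1..r}"
      unfolding disjoint_family_on_def
    proof (intro ballI impI)
      fix i j assume ij: "i \<in> {1..r}" "j \<in> {1..r}" "i \<noteq> j"
      then have "g i \<noteq> g j" using bij_betw_imp_inj_on[OF g] inj_onD by metis
      then have "g i \<inter> g j = {}" using pairwiseD[OF G(3)] gG ij by (simp add: disjnt_def)
      moreover have "g i \<subseteq> {..<n}" "g j \<subseteq> {..<n}"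
        using gG[OF ij(1)] gG[OF ij(2)] G(1) by (auto simp: E_def)
      ultimately show "\<sigma> ` g i \<inter> \<sigma> ` g j = {}"
        using inj_on_image_Int[OF bij_betw_imp_inj_on[OF \<sigma>(1)], of "g i" "g j"] by simp
    qed
  qed
qed

section \<open>Chromatic numbers and estimates\<close>

text \<open>An injective colouring is proper when every edge has two vertices, so the least number
  of colours exists and is attained.\<close>

lemma chromatic_number_coloring:
  assumes "finite (verts G)" "\<And>F. F \<in> edges G \<Longrightarrow> F \<subseteq> verts G \<and> card F \<ge> 2"
  obtains col where "proper_coloring G (chromatic_number G) col"
proof -
  obtain f :: "'a \<Rightarrow> nat" where f: "bij_betw f (verts G) {0..<card (verts G)}"
    using ex_bij_betw_finite_nat[OF assms(1)] by blast
  have "\<not> (\<exists>a. \<forall>v\<in>F. f v = a)" if F: "F \<in> edges G" for F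
  proof
    assume "\<exists>a. \<forall>v\<in>F. f v = a"
    then obtain a where "f ` F \<subseteq> {a}" by auto
    then have "card (f ` F) \<le> 1" using card_mono[of "{a}" "f ` F"] by simp
    moreover have "inj_on f F" using f assms(2)[OF F] by (auto simp: bij_betw_def intro: inj_on_subset)
    ultimately show False using assms(2)[OF F] by (simp add: card_image)
  qed
  moreover have "f ` verts G \<subseteq> {..<card (verts G)}" using f by (auto simp: bij_betw_def)
  ultimately have "proper_coloring G (card (verts G)) f" by (simp add: proper_coloring_def)
  then have "\<exists>k c. proper_coloring G k c" by blast
  then have "\<exists>c. proper_coloring G (chromatic_number G) c"
    unfolding chromatic_number_def by (rule LeastI_ex)
  then show ?thesis using that by blast
qed

lemma prob_all_False:
  assumes "finite I" "K \<subseteq> I" "0 \<le> \<rho>" "\<rho> \<le> 1"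
  shows "measure_pmf.prob (Pi_pmf I False (\<lambda>_. bernoulli_pmf \<rho>)) {\<omega>. \<forall>F\<in>K. \<not> \<omega> F} = (1 - \<rho>) ^ card K"
proof -
  have eq: "{\<omega>. \<forall>F\<in>K. \<not> \<omega> F} = Pi I (\<lambda>F. if F \<in> K then {False} else UNIV)"
    using assms(2) by (auto simp: Pi_def)
  have "measure_pmf.prob (Pi_pmf I False (\<lambda>_. bernoulli_pmf \<rho>)) {\<omega>. \<forall>F\<in>K. \<not> \<omega> F}
     = (\<Prod>F\<in>I. if F \<in> K then 1 - \<rho> else 1)"
    unfolding eq using assms
    by (subst measure_Pi_pmf_Pi) (auto simp: measure_pmf_single intro!: prod.cong)
  also have "\<dots> = (\<Prod>F\<in>K. 1 - \<rho>)"
    using assms by (subst prod.inter_restrict[symmetric]) (auto simp: Int_absorb1)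
  finally show ?thesis by simp
qed

lemma power_div_fact_le_exp:
  assumes "x \<ge> 0"
  shows "x ^ n / fact n \<le> exp (x::real)"
proof -
  have "(\<Sum>k\<in>{n}. x ^ k /\<^sub>R fact k) \<le> (\<Sum>k. x ^ k /\<^sub>R fact k)"
    using assms by (intro sum_le_suminf summable_exp_generic) auto
  then show ?thesis by (simp add: exp_def divide_inverse mult.commute)
qed

text \<open>The binomial coefficient is at most (Dt)^t / t!, and t^t / t! is a single term of the
  series of exp t.\<close>

lemma binomial_le_exp:
  assumes "Q \<le> D * t" "D \<ge> 1" "t \<ge> 1"
  shows "real (Q choose t) \<le> exp (real t * (1 + ln (real D)))"
proof -
  have "real (Q choose t) * fact t = real ((Q choose t) * fact t)" by simp
  also have "\<dots> \<le> real (Q ^ t)" by (intro of_nat_mono binomial_fact_pow)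
  also have "\<dots> \<le> real ((D * t) ^ t)" using assms(1) by (intro of_nat_mono power_mono) auto
  also have "\<dots> = real D ^ t * real t ^ t" by (simp add: power_mult_distrib)
  finally have "real (Q choose t) \<le> real D ^ t * (real t ^ t / fact t)" by (simp add: field_simps)
  also have "\<dots> \<le> real D ^ t * exp (real t)" by (intro mult_left_mono power_div_fact_le_exp) auto
  also have "real D ^ t = exp (real t * ln (real D))" using assms(2) by (simp add: exp_of_nat_mult)
  finally show ?thesis by (simp add: exp_add[symmetric] algebra_simps)
qed


section \<open>The union bound\<close>

text \<open>Members of different \<open>U i\<close> are disjoint and nonempty, hence distinct. The
  image of a transversal therefore has \<open>r\<close> elements and determines the
  transversal.\<close>

lemma transversal_edges:
  assumes H: "hypergraph H" and B: "disjoint_family_on B {1..r}"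
    and U: "\<And>i. i \<in> {1..r} \<Longrightarrow> U i \<subseteq> {e\<in>edges H. e \<subseteq> B i} \<and> card (U i) = t"
  defines "K \<equiv> (\<lambda>e. e ` {1..r}) ` (\<Pi>\<^sub>E i\<in>{1..r}. U i)"
  shows "K \<subseteq> edges (KG r H)" "card K = t ^ r"
proof -
  have sep: "i = j" if "i \<in> {1..r}" "j \<in> {1..r}" "x \<in> U i" "y \<in> U j" "\<not> disjnt x y" for i j x y
  proof (rule ccontr)
    assume "i \<noteq> j"
    then have "B i \<inter> B j = {}" using B that by (auto simp: disjoint_family_on_def)
    moreover have "x \<subseteq> B i" "y \<subseteq> B j" using U that by blast+
    ultimately show False using that(5) by (auto simp: disjnt_def)
  qed
  have nd: "\<not> disjnt x x" if "i \<in> {1..r}" "x \<in> U i" for i x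
    using U[OF that(1)] that(2) H by (auto simp: hypergraph_def disjnt_def)
  have eq_index: "i = j" if "e \<in> (\<Pi>\<^sub>E i\<in>{1..r}. U i)" "f \<in> (\<Pi>\<^sub>E i\<in>{1..r}. U i)"
    "i \<in> {1..r}" "j \<in> {1..r}" "e i = f j" for e f i j
    using sep[of i j "e i" "f j"] nd[of i "e i"] PiE_mem[OF that(1,3)] PiE_mem[OF that(2,4)] that(3-5)
    by simp
  show "K \<subseteq> edges (KG r H)"
  proof
    fix F assume "F \<in> K"
    then obtain e where e: "e \<in> (\<Pi>\<^sub>E i\<in>{1..r}. U i)" "F = e ` {1..r}" by (auto simp: K_def)
    have "inj_on e {1..r}" using eq_index[OF e(1) e(1)] by (auto simp: inj_on_def)
    then have "card F = r" using e(2) by (simp add: card_image)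
    moreover have "F \<subseteq> edges H" unfolding e(2) using PiE_mem[OF e(1)] U by blast
    moreover have "pairwise disjnt F"
      unfolding e(2) pairwise_image
    proof (rule pairwiseI, intro impI)
      fix i j assume "i \<in> {1..r}" "j \<in> {1..r}" "i \<noteq> j"
      then show "disjnt (e i) (e j)" using sep[of i j "e i" "e j"] PiE_mem[OF e(1)] by blast
    qed
    ultimately show "F \<in> edges (KG r H)" by (simp add: KG_def)
  qed
  have "inj_on (\<lambda>e. e ` {1..r}) (\<Pi>\<^sub>E i\<in>{1..r}. U i)"
  proof (rule inj_onI)
    fix e f assume ef: "e \<in> (\<Pi>\<^sub>E i\<in>{1..r}. U i)" "f \<in> (\<Pi>\<^sub>E i\<in>{1..r}. U i)" "e ` {1..r} = f ` {1..r}"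
    show "e = f"
    proof (rule PiE_ext[OF ef(1,2)])
      fix i assume i: "i \<in> {1..r}"
      then have "e i \<in> f ` {1..r}" unfolding ef(3)[symmetric] by (rule imageI)
      then obtain j where "j \<in> {1..r}" "e i = f j" by auto
      with eq_index[OF ef(1,2) i] show "e i = f i" by metis
    qed
  qed
  then have "card K = (\<Prod>i\<in>{1..r}. card (U i))"
    unfolding K_def by (simp add: card_image card_PiE)
  also have "\<dots> = (\<Prod>i\<in>{1..r}. t)" using U by (intro prod.cong) auto
  finally show "card K = t ^ r" by simp
qed

lemma random_KG_chromatic_bound:
  fixes H :: "'a hypergraph" and r t d Q :: nat and \<rho> :: real
  assumes H: "hypergraph H" and r: "r \<ge> 2" and t: "t \<ge> 1" and d: "d \<ge> 2" and Q: "Q \<ge> 1"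
    and Q1: "(d - 1) * (t - 1) + 1 \<le> Q" and Q2: "Q \<le> (d - 1) * t" and \<rho>: "0 < \<rho>" "\<rho> \<le> 1"
  defines "m \<equiv> min ((real (card (verts H)) - real (alt_num r H (int Q))) / (real r - 1)) (real d)"
  shows "measure_pmf.prob (random_KG r H \<rho>) {G. real (chromatic_number G) \<ge> m} \<ge>
     1 - exp (real (card (verts H)) * ln (real r + 1)
              + real r * real t * (1 + ln (real d - 1)) - \<rho> * real t ^ r)"
proof -
  define V where "V = verts H"
  define n where "n = card V"
  have finV: "finite V" using H by (simp add: hypergraph_def V_def)
  have "edges H \<subseteq> Pow V" using H by (auto simp: hypergraph_def V_def)
  then have finE: "finite (edges H)" using finV finite_subset by blast
  define I where "I = edges (KG r H)"
  have "I \<subseteq> Pow (edges H)" by (auto simp: I_def KG_def)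
  then have finI: "finite I" using finE finite_subset by blast
  define P where "P = Pi_pmf I False (\<lambda>_. bernoulli_pmf \<rho>)"
  define G where "G \<omega> = (edges H, {F\<in>I. \<omega> F})" for \<omega>
  \<comment> \<open>The size is bounded by \<open>Q\<close> even for sets \<open>A\<close> spanning
    fewer than \<open>Q\<close> edges: the union bound runs over all vectors \<open>X\<close>, whose
    classes may be such sets.\<close>
  have "\<forall>A. \<exists>F. F \<subseteq> {e\<in>edges H. e \<subseteq> A} \<and> card F \<le> Q \<and>
      (card {e\<in>edges H. e \<subseteq> A} \<ge> Q \<longrightarrow> card F = Q)"
  proof
    fix A
    show "\<exists>F. F \<subseteq> {e\<in>edges H. e \<subseteq> A} \<and> card F \<le> Q \<and>
      (card {e\<in>edges H. e \<subseteq> A} \<ge> Q \<longrightarrow> card F = Q)"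
    proof (cases "card {e\<in>edges H. e \<subseteq> A} \<ge> Q")
      case True
      then obtain F where "F \<subseteq> {e\<in>edges H. e \<subseteq> A}" "card F = Q"
        by (rule obtain_subset_with_card_n)
      then show ?thesis by auto
    next
      case False
      then show ?thesis by (intro exI[of _ "{}"]) auto
    qed
  qed
  then obtain Fs where "\<forall>A. Fs A \<subseteq> {e\<in>edges H. e \<subseteq> A} \<and> card (Fs A) \<le> Q \<and>
      (card {e\<in>edges H. e \<subseteq> A} \<ge> Q \<longrightarrow> card (Fs A) = Q)"
    unfolding choice_iff by (rule exE)
  then have Fs: "\<And>A. Fs A \<subseteq> {e\<in>edges H. e \<subseteq> A}" "\<And>A. card (Fs A) \<le> Q"
    "\<And>A. card {e\<in>edges H. e \<subseteq> A} \<ge> Q \<Longrightarrow> card (Fs A) = Q"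
    by auto
  have finFs: "finite (Fs A)" for A
    using finite_subset[OF Fs(1)[of A]] finE by simp
  \<comment> \<open>A map \<open>X\<close> encodes \<open>r\<close> disjoint vertex sets, with 0 for
    the vertices in none of them; an element of \<open>Us X\<close> picks \<open>t\<close> edges
    from the family of each.\<close>
  define B where "B X i = {v\<in>V. X v = i}" for X :: "'a \<Rightarrow> nat" and i
  define Us where "Us X = (\<Pi>\<^sub>E i\<in>{1..r}. {U. U \<subseteq> Fs (B X i) \<and> card U = t})" for X
  define idx where "idx = Sigma (V \<rightarrow>\<^sub>E {0..r}) Us"
  define K where "K U = (\<lambda>e. e ` {1..r}) ` (\<Pi>\<^sub>E i\<in>{1..r}. U i)" for U :: "nat \<Rightarrow> 'a set set"
  define miss where "miss U = {\<omega>. \<forall>F\<in>K U. \<not> \<omega> F}" for U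
  have fin_dom: "finite (V \<rightarrow>\<^sub>E {0..r})" using finV by (intro finite_PiE) auto
  have fin_Us: "finite (Us X)" for X
    unfolding Us_def using finFs by (intro finite_PiE) auto
  have fin_idx: "finite idx" unfolding idx_def using fin_dom fin_Us by auto

  have bad: "{\<omega>. \<not> m \<le> real (chromatic_number (G \<omega>))} \<subseteq> (\<Union>(X, U)\<in>idx. miss U)"
  proof
    fix \<omega> assume "\<omega> \<in> {\<omega>. \<not> m \<le> real (chromatic_number (G \<omega>))}"
    define k where "k = chromatic_number (G \<omega>)"
    have k: "real k < m" using \<open>\<omega> \<in> _\<close> by (simp add: k_def)
    obtain col where col: "proper_coloring (G \<omega>) k col"
      unfolding k_def
      by (rule chromatic_number_coloring[of "G \<omega>"])
         (use finE r in \<open>auto simp: G_def I_def KG_def\<close>)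
    have "real k < real d" using k by (simp add: m_def)
    \<comment> \<open>Fewer than \<open>d\<close> colours and the lower bound on \<open>Q\<close>
      are what the pigeonhole argument needs on a family of size \<open>Q\<close>.\<close>
    then have "k \<le> d - 1" by simp
    then have "k * (t - 1) \<le> (d - 1) * (t - 1)" by (rule mult_le_mono1)
    with Q1 have k1: "k * (t - 1) < Q" by linarith
    have "real k < (real n - real (alt_num r H (int Q))) / (real r - 1)"
      using k by (simp add: m_def n_def V_def)
    then have "real k * (real r - 1) < real n - real (alt_num r H (int Q))"
      using r by (simp add: pos_less_divide_eq)
    moreover have "real k * (real r - 1) = real (k * (r - 1))" using r by (simp add: of_nat_diff)
    ultimately have "real (k * (r - 1) + alt_num r H (int Q)) < real n" by simp
    then have k2: "k * (r - 1) + alt_num r H (int Q) < card (verts H)"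
      unfolding of_nat_less_iff by (simp add: n_def V_def)
    have col_sub: "col ` edges H \<subseteq> {..<k}" using col by (simp add: proper_coloring_def G_def)
    have "\<exists>A a. (\<forall>i\<in>{1..r}. A i \<subseteq> verts H \<and> Q \<le> card {e\<in>edges H. e \<subseteq> A i} \<and>
        t \<le> card {e\<in>Fs (A i). col e = a}) \<and> disjoint_family_on A {1..r}"
      by (rule disjoint_monochromatic_families[OF H r Q _ col_sub k1 k2])
         (intro conjI Fs(1) Fs(3))
    then obtain A a where A: "\<forall>i\<in>{1..r}. A i \<subseteq> V \<and> Q \<le> card {e\<in>edges H. e \<subseteq> A i} \<and>
        t \<le> card {e\<in>Fs (A i). col e = a}"
      and disj: "disjoint_family_on A {1..r}"
      unfolding V_def by (elim exE conjE)
    have A: "A i \<subseteq> V" "t \<le> card {e\<in>Fs (A i). col e = a}" if "i \<in> {1..r}" for i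
      using A that by auto
    \<comment> \<open>The sets \<open>A i\<close> are encoded as classes of a map; disjointness
      makes the index unique.\<close>
    define X where "X = (\<lambda>v\<in>V. if \<exists>i\<in>{1..r}. v \<in> A i then THE i. i \<in> {1..r} \<and> v \<in> A i else 0)"
    have X_eq: "X v = i" if "i \<in> {1..r}" "v \<in> A i" for v i
    proof -
      have "(THE i. i \<in> {1..r} \<and> v \<in> A i) = i"
        using that disj unfolding disjoint_family_on_def by (intro the_equality) blast+
      then show ?thesis using that A[OF that(1)] by (auto simp: X_def)
    qed
    have X_zero: "X v = 0" if "v \<in> V" "\<not> (\<exists>i\<in>{1..r}. v \<in> A i)" for v
      using that by (simp add: X_def)
    have X_in: "X \<in> V \<rightarrow>\<^sub>E {0..r}"
    proof (rule PiE_I)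
      fix v assume "v \<in> V"
      then show "X v \<in> {0..r}"
        using X_eq[of _ v] X_zero[of v] by (cases "\<exists>i\<in>{1..r}. v \<in> A i") auto
    qed (simp add: X_def)
    have BX: "B X i = A i" if "i \<in> {1..r}" for i
    proof -
      have "v \<in> A i" if "v \<in> V" "X v = i" for v
      proof -
        have "\<exists>j\<in>{1..r}. v \<in> A j" using X_zero[OF that(1)] that(2) \<open>i \<in> {1..r}\<close> by force
        then show ?thesis using X_eq[of _ v] that(2) by blast
      qed
      then show ?thesis using X_eq[OF that] A[OF that] by (auto simp: B_def)
    qed
    have "\<forall>i\<in>{1..r}. \<exists>U. U \<subseteq> {e\<in>Fs (A i). col e = a} \<and> card U = t"
    proof
      fix i assume "i \<in> {1..r}"
      from obtain_subset_with_card_n[OF A(2)[OF this]]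
      show "\<exists>U. U \<subseteq> {e\<in>Fs (A i). col e = a} \<and> card U = t" by metis
    qed
    from bchoice[OF this] obtain U
      where U: "\<forall>i\<in>{1..r}. U i \<subseteq> {e\<in>Fs (A i). col e = a} \<and> card (U i) = t" ..
    define U' where "U' = restrict U {1..r}"
    have "U' \<in> Us X"
      unfolding Us_def U'_def
    proof (rule restrict_PiE_iff[THEN iffD2], rule ballI)
      fix i assume i: "i \<in> {1..r}"
      show "U i \<in> {U. U \<subseteq> Fs (B X i) \<and> card U = t}" unfolding BX[OF i] using bspec[OF U i] by auto
    qed
    then have in_idx: "(X, U') \<in> idx" using X_in by (simp add: idx_def)
    have "\<omega> \<in> miss U'"
      unfolding miss_def
    proof (intro CollectI ballI notI)
      fix F assume F: "F \<in> K U'" "\<omega> F"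
      have "K U' \<subseteq> edges (KG r H)" unfolding K_def
      proof (rule transversal_edges(1)[OF H disj, of _ t])
        fix i assume i: "i \<in> {1..r}"
        have "U' i = U i" using i by (simp add: U'_def)
        then show "U' i \<subseteq> {e\<in>edges H. e \<subseteq> A i} \<and> card (U' i) = t"
          using bspec[OF U i] Fs(1)[of "A i"] by auto
      qed
      with F have "F \<in> edges (G \<omega>)" by (auto simp: G_def I_def)
      then have "\<not> (\<forall>v\<in>F. col v = a)" using col unfolding proper_coloring_def by blast
      moreover have "col v = a" if "v \<in> F" for v
      proof -
        obtain e where e: "e \<in> (\<Pi>\<^sub>E i\<in>{1..r}. U' i)" "F = e ` {1..r}" using F by (auto simp: K_def)
        with that obtain i where i: "i \<in> {1..r}" "v = e i" by auto
        then have "v \<in> U i" using PiE_mem[OF e(1) i(1)] by (simp add: U'_def)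
        then show ?thesis using bspec[OF U i(1)] by auto
      qed
      ultimately show False by blast
    qed
    with in_idx show "\<omega> \<in> (\<Union>(X, U)\<in>idx. miss U)" by auto
  qed

  have prob_miss: "measure_pmf.prob P (miss U) = (1 - \<rho>) ^ (t ^ r)" if "(X, U) \<in> idx" for X U
  proof -
    have U: "U i \<subseteq> {e\<in>edges H. e \<subseteq> B X i} \<and> card (U i) = t" if "i \<in> {1..r}" for i
    proof -
      have "U \<in> Us X" using \<open>(X, U) \<in> idx\<close> by (simp add: idx_def)
      from PiE_mem[OF this[unfolded Us_def] that] show ?thesis using Fs(1)[of "B X i"] by blast
    qed
    have disj: "disjoint_family_on (B X) {1..r}" by (auto simp: disjoint_family_on_def B_def)
    have "K U \<subseteq> I" "card (K U) = t ^ r"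
      unfolding K_def I_def using transversal_edges[OF H disj U] by auto
    then show ?thesis unfolding P_def miss_def using prob_all_False[OF finI] \<rho> by simp
  qed

  have card_idx: "card idx \<le> (r + 1) ^ n * (Q choose t) ^ r"
  proof -
    have "card idx = (\<Sum>X\<in>V \<rightarrow>\<^sub>E {0..r}. card (Us X))"
      unfolding idx_def using fin_dom fin_Us by (simp add: card_SigmaI)
    also have "\<dots> \<le> (\<Sum>X\<in>V \<rightarrow>\<^sub>E {0..r}. (Q choose t) ^ r)"
    proof (rule sum_mono)
      fix X
      have "card (Us X) = (\<Prod>i\<in>{1..r}. card (Fs (B X i)) choose t)"
        unfolding Us_def by (simp add: card_PiE n_subsets[OF finFs])
      also have "\<dots> \<le> (\<Prod>i\<in>{1..r}. Q choose t)"
        using Fs(2) by (intro prod_mono) (auto intro: binomial_right_mono)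
      finally show "card (Us X) \<le> (Q choose t) ^ r" by simp
    qed
    also have "\<dots> = (r + 1) ^ n * (Q choose t) ^ r"
      using finV by (simp add: card_PiE n_def)
    finally show ?thesis .
  qed

  have "measure_pmf.prob P {\<omega>. \<not> m \<le> real (chromatic_number (G \<omega>))}
      \<le> measure_pmf.prob P (\<Union>(X, U)\<in>idx. miss U)"
    using bad by (intro measure_pmf.finite_measure_mono) auto
  also have "\<dots> = measure_pmf.prob P (\<Union>x\<in>idx. miss (snd x))"
    by (simp add: case_prod_unfold)
  also have "\<dots> \<le> (\<Sum>x\<in>idx. measure_pmf.prob P (miss (snd x)))"
    using fin_idx by (intro measure_pmf.finite_measure_subadditive_finite) auto
  also have "\<dots> = (\<Sum>x\<in>idx. (1 - \<rho>) ^ (t ^ r))"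
    using prob_miss by (intro sum.cong) auto
  also have "\<dots> = real (card idx) * (1 - \<rho>) ^ (t ^ r)" by simp
  also have "\<dots> \<le> real ((r + 1) ^ n * (Q choose t) ^ r) * (1 - \<rho>) ^ (t ^ r)"
    using card_idx \<rho> by (intro mult_right_mono of_nat_mono) auto
  \<comment> \<open>The binomial estimate is used with \<open>D = d - 1\<close>, and
    \<open>1 - \<rho>\<close> is bounded by \<open>exp (- \<rho>)\<close>.\<close>
  also have "\<dots> \<le> (exp (real n * ln (real r + 1)) * exp (real t * (1 + ln (real (d - 1)))) ^ r)
      * exp (- \<rho>) ^ (t ^ r)"
  proof (intro mult_mono power_mono)
    have "real ((r + 1) ^ n * (Q choose t) ^ r) = (real r + 1) ^ n * real (Q choose t) ^ r"
      by (simp add: add.commute)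
    also have "\<dots> \<le> (real r + 1) ^ n * exp (real t * (1 + ln (real (d - 1)))) ^ r"
      using Q2 d t by (intro mult_left_mono power_mono binomial_le_exp) auto
    also have "(real r + 1) ^ n = exp (real n * ln (real r + 1))"
      by (simp add: exp_of_nat_mult)
    finally show "real ((r + 1) ^ n * (Q choose t) ^ r) \<le>
        exp (real n * ln (real r + 1)) * exp (real t * (1 + ln (real (d - 1)))) ^ r" .
    show "1 - \<rho> \<le> exp (- \<rho>)" using exp_ge_add_one_self[of "- \<rho>"] by simp
  qed (use \<rho> in auto)
  also have "\<dots> = exp (real n * ln (real r + 1) + real r * (real t * (1 + ln (real (d - 1))))
      + real (t ^ r) * (- \<rho>))"
    by (simp only: exp_add exp_of_nat_mult)
  also have "\<dots> = exp (real (card (verts H)) * ln (real r + 1)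
              + real r * real t * (1 + ln (real d - 1)) - \<rho> * real t ^ r)"
    using d by (simp add: n_def V_def of_nat_diff algebra_simps)
  finally have upper: "measure_pmf.prob P {\<omega>. \<not> m \<le> real (chromatic_number (G \<omega>))} \<le> \<dots>" .

  have "measure_pmf.prob (random_KG r H \<rho>) {G. real (chromatic_number G) \<ge> m}
      = measure_pmf.prob P {\<omega>. m \<le> real (chromatic_number (G \<omega>))}"
    by (simp add: random_KG_def P_def G_def I_def KG_def vimage_def)
  also have "\<dots> = 1 - measure_pmf.prob P {\<omega>. \<not> m \<le> real (chromatic_number (G \<omega>))}"
    using measure_pmf.prob_compl[of "{\<omega>. \<not> m \<le> real (chromatic_number (G \<omega>))}" P]
    by (simp add: Compl_eq_Diff_UNIV[symmetric] Collect_neg_eq[symmetric])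
  finally show ?thesis using upper by linarith
qed

text \<open>The filter \<open>filtercomap n at_top\<close> expresses that the number of vertices
  \<open>n m\<close>, rather than the index \<open>m\<close>, tends to infinity.\<close>

theorem theorem1:
  fixes H :: "nat \<Rightarrow> 'a hypergraph"
    and n :: "nat \<Rightarrow> nat"
    and r :: "nat \<Rightarrow> nat"
    and t d q :: "nat \<Rightarrow> int"
    and \<rho> :: "nat \<Rightarrow> real"
  assumes "\<And>m. hypergraph (H m)"
    and "inj H"
    and "\<And>m. n m = card (verts (H m))"
    and "\<And>m. r (n m) \<ge> 2"
    and "\<And>m. q (n m) \<ge> 1"
    and "\<And>m. (d (n m) - 1) * (t (n m) - 1) + 1 \<le> q (n m)"
    and "\<And>m. q (n m) \<le> (d (n m) - 1) * t (n m)"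
    and "\<And>m. 0 < \<rho> (n m) \<and> \<rho> (n m) \<le> 1"
    and "filterlim
          (\<lambda>m. real (n m) * ln (real (r (n m)) + 1)
             + real (r (n m)) * real_of_int (t (n m)) * (1 + ln (real_of_int (d (n m)) - 1))
             - \<rho> (n m) * real_of_int (t (n m)) ^ r (n m))
          at_bot (filtercomap n at_top)"
  shows "((\<lambda>m. measure_pmf.prob (random_KG (r (n m)) (H m) (\<rho> (n m)))
            {G. real (chromatic_number G) \<ge>
                min ((real (card (verts (H m))) - real (alt_num (r (n m)) (H m) (q (n m))))
                       / (real (r (n m)) - 1))
                    (real_of_int (d (n m)))})
          \<longlongrightarrow> 1) (filtercomap n at_top)"
    (is "((\<lambda>m. ?prob m) \<longlongrightarrow> 1) ?F")
proof -
  define x where "x m = real (n m) * ln (real (r (n m)) + 1)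
             + real (r (n m)) * real_of_int (t (n m)) * (1 + ln (real_of_int (d (n m)) - 1))
             - \<rho> (n m) * real_of_int (t (n m)) ^ r (n m)" for m
  have lower: "1 - exp (x m) \<le> ?prob m" for m
  \<comment> \<open>As \<open>q \<ge> 1\<close>, the product of \<open>d - 1\<close> and
    \<open>t\<close> is positive. With \<open>d \<ge> 1\<close> this gives \<open>d \<ge> 2\<close>
    and \<open>t \<ge> 1\<close>; otherwise \<open>d \<le> 0\<close>, the claimed minimum is at most
    0, and the event is certain.\<close>
  proof (cases "d (n m) \<ge> 1")
    case True
    have pos: "0 < (d (n m) - 1) * t (n m)" using assms(5,7)[of m] by linarith
    with True have d: "d (n m) \<ge> 2" by (cases "d (n m) = 1") auto
    with pos have t: "t (n m) \<ge> 1" by (simp add: zero_less_mult_iff)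
    define d' t' q' where "d' = nat (d (n m))" and "t' = nat (t (n m))" and "q' = nat (q (n m))"
    have eqs: "d (n m) = int d'" "t (n m) = int t'" "q (n m) = int q'"
      using d t assms(5)[of m] by (simp_all add: d'_def t'_def q'_def)
    have "d' \<ge> 2" "t' \<ge> 1" "q' \<ge> 1" using d t assms(5)[of m] by (simp_all add: eqs)
    have "int ((d' - 1) * (t' - 1) + 1) = (d (n m) - 1) * (t (n m) - 1) + 1"
      "int ((d' - 1) * t') = (d (n m) - 1) * t (n m)"
      using \<open>d' \<ge> 2\<close> \<open>t' \<ge> 1\<close> by (simp_all add: eqs of_nat_diff)
    with assms(6,7)[of m] have "(d' - 1) * (t' - 1) + 1 \<le> q'" "q' \<le> (d' - 1) * t'"
      by (simp_all only: eqs(3) of_nat_le_iff[symmetric, where 'a = int])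
    from random_KG_chromatic_bound[OF assms(1)[of m] assms(4)[of m] \<open>t' \<ge> 1\<close> \<open>d' \<ge> 2\<close> \<open>q' \<ge> 1\<close> this
        assms(8)[of m, THEN conjunct1] assms(8)[of m, THEN conjunct2]]
    show ?thesis by (simp add: x_def eqs assms(3)[symmetric])
  next
    case False
    then have "{G. real (chromatic_number G) \<ge>
                min ((real (card (verts (H m))) - real (alt_num (r (n m)) (H m) (q (n m))))
                       / (real (r (n m)) - 1))
                    (real_of_int (d (n m)))} = (UNIV :: 'a set hypergraph set)"
      by (auto simp: min_le_iff_disj intro: order.trans[of _ 0])
    then show ?thesis by simp
  qed
  have "((\<lambda>m. exp (x m)) \<longlongrightarrow> 0) ?F"
    using filterlim_compose[OF exp_at_bot assms(9)] by (simp add: x_def)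
  then have "((\<lambda>m. 1 - exp (x m)) \<longlongrightarrow> 1 - 0) ?F" by (intro tendsto_intros)
  then have "((\<lambda>m. 1 - exp (x m)) \<longlongrightarrow> 1) ?F" by simp
  then show ?thesis
    by (rule tendsto_sandwich[rotated 2, OF _ tendsto_const])
       (use lower in \<open>auto intro!: always_eventually\<close>)
qed

end
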